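(* Let $\mathcal B\in\Pi^d$, $1\le p<\infty$ and $u\in BV_{\mathcal B}(Q)\cap L^p(Q)$. There exists a sequence $\{u_n\}_{n=1}^\infty\subset C^\infty(Q)\cap BV_{\mathcal B}(Q)$ such that: 1. $u_n\to u$ strongly in $L^p(Q)$; 2. $PV_{\mathcal B}(u_n)\to PV_{\mathcal B}(u)$; 3. $u_n\in C^\infty(\overline Q)$ for each $n\in\mathbb N$.
   Context: Let $d,N\ge1$ be integers and $Q=(0,1)^N$. For $1\le h\le d$, $H^hu\in\mathcal D'(Q;\mathbb R^{N^h})$ is the array of all $h$-th order distributional partial derivatives of $u$. Put $K=\sum_{h=1}^dN^h$, so $\mathbb R^K=\bigoplus_{h=1}^d\mathbb R^{N^h}$. $\Pi^d$ is the set of operators $\mathcal B$ given by real matrices $B^h\in\mathbb R^{N^h\times N^h}$, $1\le h\le d$, through $\mathcal Bu=(B^1H^1u,\dots,B^dH^du)\in\mathcal D'(Q;\mathbb R^K)$. $\mathcal B^*$ is the formal adjoint: $\int_Qu\,\mathcal B^*\varphi\,dx=\int_Q\varphi\cdot\mathcal Bu\,dx$ for $\varphi\in C_c^\infty(Q;\mathbb R^K)$ and smooth $u$. For $u\in L^1(Q)$, $PV_{\mathcal B}(u)=\sup\{\int_Qu\,\mathcal B^*\varphi\,dx:\varphi\in C_c^\infty(Q;\mathbb R^K),\ |\varphi|\le1\}\in[0,+\infty]$ (Euclidean norm on $\mathbb R^K$), and $BV_{\mathcal B}(Q)=\{u\in L^1(Q):PV_{\mathcal B}(u)<+\infty\}$.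 *)

theory Defs
  imports "HOL-Analysis.Analysis"
begin

(* The dimension N is CARD('n).  Functions on Q are represented by total functions on
   real ^ 'n whose values off Q are irrelevant, unless support or closure of Q is mentioned. *)

definition Q :: "(real ^ 'n::finite) set" where
  "Q = {x. \<forall>i. 0 < x $ i \<and> x $ i < 1}"

definition partial_deriv :: "'n::finite \<Rightarrow> (real ^ 'n \<Rightarrow> real) \<Rightarrow> real ^ 'n \<Rightarrow> real" where
  "partial_deriv i f x = frechet_derivative f (at x) (axis i 1)"

(* A list of length h names an entry of the array of h-th order partial derivatives
   (there are N^h of them). *)
primrec iter_deriv :: "'n::finite list \<Rightarrow> (real ^ 'n \<Rightarrow> real) \<Rightarrow> real ^ 'n \<Rightarrow> real" where
  "iter_deriv [] f = f"
| "iter_deriv (i # J) f = partial_deriv i (iter_deriv J f)"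

(* Only used for open S, where the derivatives do not see values outside S. *)
definition smooth_on :: "(real ^ 'n::finite) set \<Rightarrow> (real ^ 'n \<Rightarrow> real) \<Rightarrow> bool" where
  "smooth_on S f \<longleftrightarrow> (\<forall>J. \<forall>x\<in>S. iter_deriv J f differentiable (at x))"

(* Smoothness up to the boundary: agreeing on the closed cube with a smooth function
   on the whole space. *)
definition smooth_closure :: "(real ^ 'n::finite \<Rightarrow> real) \<Rightarrow> bool" where
  "smooth_closure f \<longleftrightarrow> (\<exists>F. smooth_on UNIV F \<and> (\<forall>x\<in>closure Q. f x = F x))"

(* Elements of C_c^infinity(Q) are extended by zero to the whole space. *)
definition test_fun :: "(real ^ 'n::finite \<Rightarrow> real) \<Rightarrow> bool" where
  "test_fun f \<longleftrightarrow> smooth_on UNIV f \<and>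
     compact (closure {x. f x \<noteq> 0}) \<and> closure {x. f x \<noteq> 0} \<subseteq> Q"

definition words :: "nat \<Rightarrow> 'n::finite list set" where
  "words h = {J. length J = h}"

(* The K coordinates of R^K = R^N + R^(N^2) + ... + R^(N^d). *)
definition coords :: "nat \<Rightarrow> 'n::finite list set" where
  "coords d = (\<Union>h\<in>{1..d}. words h)"

(* B h I J is the (I,J) entry of the matrix B^h; only h in {1..d} and I, J in words h matter.
   For I in words h, the I-th coordinate of B u is the I-th coordinate of B^h H^h u;
   for smooth u the distributional derivatives are the classical ones. *)
type_synonym 'n diff_op = "nat \<Rightarrow> 'n list \<Rightarrow> 'n list \<Rightarrow> real"

definition apply_op ::
    "'n::finite diff_op \<Rightarrow> (real ^ 'n \<Rightarrow> real) \<Rightarrow> 'n list \<Rightarrow> real ^ 'n \<Rightarrow> real" where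
  "apply_op B u I x = (\<Sum>J\<in>words (length I). B (length I) I J * iter_deriv J u x)"

(* R^K-valued fields are given by their coordinate functions \<phi> I, I in coords d. *)
definition test_field :: "nat \<Rightarrow> ('n::finite list \<Rightarrow> real ^ 'n \<Rightarrow> real) \<Rightarrow> bool" where
  "test_field d \<phi> \<longleftrightarrow> (\<forall>I\<in>coords d. test_fun (\<phi> I))"

(* Existence of \<psi> is integration by parts; uniqueness follows by testing the difference
   of two candidates against itself. *)
definition formal_adjoint ::
    "nat \<Rightarrow> 'n::finite diff_op \<Rightarrow> ('n list \<Rightarrow> real ^ 'n \<Rightarrow> real) \<Rightarrow> real ^ 'n \<Rightarrow> real" where
  "formal_adjoint d B \<phi> = (THE \<psi>. test_fun \<psi> \<and>
     (\<forall>u. smooth_on Q u \<longrightarrow>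
        (LINT x|lebesgue_on Q. u x * \<psi> x) =
        (LINT x|lebesgue_on Q. (\<Sum>I\<in>coords d. \<phi> I x * apply_op B u I x))))"

definition PV :: "nat \<Rightarrow> 'n::finite diff_op \<Rightarrow> (real ^ 'n \<Rightarrow> real) \<Rightarrow> ereal" where
  "PV d B u = (SUP \<phi>\<in>{\<phi>. test_field d \<phi> \<and> (\<forall>x\<in>Q. sqrt (\<Sum>I\<in>coords d. (\<phi> I x)\<^sup>2) \<le> 1)}.
     ereal (LINT x|lebesgue_on Q. u x * formal_adjoint d B \<phi> x))"

definition BV :: "nat \<Rightarrow> 'n::finite diff_op \<Rightarrow> (real ^ 'n \<Rightarrow> real) set" where
  "BV d B = {u. integrable (lebesgue_on Q) u \<and> PV d B u < \<infinity>}"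

definition Lp :: "real \<Rightarrow> (real ^ 'n::finite \<Rightarrow> real) set" where
  "Lp p = {u. u \<in> borel_measurable (lebesgue_on Q) \<and>
              integrable (lebesgue_on Q) (\<lambda>x. \<bar>u x\<bar> powr p)}"

definition Lp_norm :: "real \<Rightarrow> (real ^ 'n::finite \<Rightarrow> real) \<Rightarrow> real" where
  "Lp_norm p u = (LINT x|lebesgue_on Q. \<bar>u x\<bar> powr p) powr (1 / p)"

end

theory Submission
  imports Defs "HOL-Computational_Algebra.Polynomial" "HOL-Probability.Probability_Measure"
begin

text \<open>Let \<open>\<eta>\<close> be a smooth probability density with compact support in \<open>Q\<close> and, for \<open>0 < t < 1\<close>, put
  \<open>v\<^sub>t x = \<integral> \<eta> z * u (t x + (1 - t) z) dz\<close>, the average over \<open>z\<close> of the dilations of \<open>u\<close> with ratio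
  \<open>t\<close> and center \<open>z\<close>. By convexity these only evaluate \<open>u\<close> inside \<open>Q\<close>, and after substituting
  \<open>y = t x + (1 - t) z\<close> the average is a convolution, hence smooth on the whole space. Moving a single
  dilation onto a test field turns its \<open>h\<close>-th order part \<open>\<phi>\<^sup>h\<close> into \<open>t\<^sup>h \<phi>\<^sup>h\<close> composed with the
  inverse dilation, which is still admissible since \<open>t \<le> 1\<close>; this gives
  \<open>PV v\<^sub>t \<le> PV u / t\<^sup>N\<close>. As \<open>t \<rightarrow> 1\<close>, \<open>v\<^sub>t \<rightarrow> u\<close> in every \<open>L\<^sup>q\<close> in which \<open>u\<close> lies (Jensen's inequality
  and density of continuous functions), and the \<open>L\<^sup>1\<close> convergence yields lower semicontinuity
  of \<open>PV\<close>.\<close>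

subsection \<open>Smooth functions\<close>

text \<open>Mollifying \<open>u\<close> directly would need its values outside \<open>Q\<close>. The
  usual repair, localisation by cutoffs, fails for orders above 1: the Leibniz rule produces
  lower-order derivatives of \<open>u\<close>, and these are not controlled by \<open>PV\<close>. An
  affine change of variables produces no such terms; it only multiplies derivatives of order h by
  the h-th power of the ratio. Since the blocks of \<open>B\<close> are square, each coordinate of
  \<open>B u\<close> involves derivatives of one order only, so this power can be absorbed by the
  test field. One parameter does both jobs: ratio \<open>t\<close> contracts \<open>Q\<close> into
  itself, and letting the center vary smooths at scale \<open>1 - t\<close>. The factor in the bound
  for \<open>PV\<close> is just the Jacobian of a dilation and tends to 1, so no error term remains
  in the limit. Before any of this applies, \<open>formal_adjoint\<close>, a definite description,
  has to be identified with an explicit sum, which is where integration by parts enters.\<close>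

lemma partial_deriv_eq: "(f has_derivative f') (at x) \<Longrightarrow> partial_deriv i f x = f' (axis i 1)"
  unfolding partial_deriv_def using frechet_derivative_at by metis

lemma partial_deriv_cong:
  assumes "open S" "x \<in> S" "\<And>y. y \<in> S \<Longrightarrow> f y = g y"
  shows "partial_deriv i f x = partial_deriv i g x"
proof -
  have "(f has_derivative D) (at x) \<longleftrightarrow> (g has_derivative D) (at x)" for D
    using assms by (metis has_derivative_transform_within_open)
  then show ?thesis unfolding partial_deriv_def frechet_derivative_def by simp
qed

lemma differentiable_cong_open:
  assumes "open S" "x \<in> S" "\<And>y. y \<in> S \<Longrightarrow> f y = g y" "f differentiable (at x)"
  shows "g differentiable (at x)"
  using assms unfolding differentiable_def by (metis has_derivative_transform_within_open)

lemma iter_deriv_append: "iter_deriv (I @ J) f = iter_deriv I (iter_deriv J f)"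
  by (induction I) auto

lemma smooth_onD: "smooth_on S f \<Longrightarrow> x \<in> S \<Longrightarrow> f differentiable (at x)"
  unfolding smooth_on_def by (metis iter_deriv.simps(1))

lemma smooth_on_iter_deriv: "smooth_on S f \<Longrightarrow> smooth_on S (iter_deriv J f)"
  unfolding smooth_on_def by (metis iter_deriv_append)

lemma smooth_on_partial_deriv: "smooth_on S f \<Longrightarrow> smooth_on S (partial_deriv i f)"
  using smooth_on_iter_deriv[of S f "[i]"] by simp

lemma smooth_on_subset: "smooth_on T f \<Longrightarrow> S \<subseteq> T \<Longrightarrow> smooth_on S f"
  unfolding smooth_on_def by blast

lemma smooth_on_continuous: "smooth_on S f \<Longrightarrow> continuous_on S f"
  by (meson continuous_at_imp_continuous_on differentiable_imp_continuous_within smooth_onD)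

text \<open>Smoothness without computing iterated derivatives: a family of differentiable functions
  that is closed under partial derivatives contains all of them. Closure is only asked up to
  equality on \<open>S\<close>; since \<open>S\<close> is open, such an equality survives another
  differentiation.\<close>

lemma smooth_on_coinduct:
  assumes S: "open S" and f: "f \<in> F"
    and diff: "\<And>f x. f \<in> F \<Longrightarrow> x \<in> S \<Longrightarrow> f differentiable (at x)"
    and step: "\<And>f i. f \<in> F \<Longrightarrow> \<exists>g\<in>F. \<forall>x\<in>S. partial_deriv i f x = g x"
  shows "smooth_on S f"
proof -
  have *: "\<exists>g\<in>F. \<forall>x\<in>S. iter_deriv J f x = g x" for J
  proof (induction J)
    case Nil
    then show ?case using f by auto
  next
    case (Cons i J)
    then obtain g where g: "g \<in> F" "\<And>x. x \<in> S \<Longrightarrow> iter_deriv J f x = g x" by blast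
    obtain g' where "g' \<in> F" "\<forall>x\<in>S. partial_deriv i g x = g' x" using step g(1) by blast
    then show ?case using partial_deriv_cong[OF S _ g(2)] by fastforce
  qed
  show ?thesis unfolding smooth_on_def
    using * diff differentiable_cong_open[OF S] by metis
qed

lemma has_derivative_frechet:
  "f differentiable (at x) \<Longrightarrow> (f has_derivative frechet_derivative f (at x)) (at x)"
  using frechet_derivative_works by blast

lemma has_derivative_partial_deriv:
  fixes f :: "real ^ 'n::finite \<Rightarrow> real"
  assumes "f differentiable (at x)"
  shows "(f has_derivative (\<lambda>h. \<Sum>i\<in>UNIV. h $ i * partial_deriv i f x)) (at x)"
proof -
  let ?D = "frechet_derivative f (at x)"
  have l: "linear ?D" using assms linear_frechet_derivative by blast
  have "?D h = (\<Sum>i\<in>UNIV. h $ i * partial_deriv i f x)" for h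
  proof -
    have "?D h = ?D (\<Sum>i\<in>UNIV. h $ i *\<^sub>R axis i 1)"
      using basis_expansion[of h] by (simp add: scalar_mult_eq_scaleR)
    also have "\<dots> = (\<Sum>i\<in>UNIV. h $ i * partial_deriv i f x)"
      by (simp add: linear_sum[OF l] linear_cmul[OF l] partial_deriv_def)
    finally show ?thesis .
  qed
  then have "?D = (\<lambda>h. \<Sum>i\<in>UNIV. h $ i * partial_deriv i f x)" by blast
  then show ?thesis using has_derivative_frechet[OF assms] by simp
qed

lemma partial_deriv_add:
  assumes "f differentiable (at x)" "g differentiable (at x)"
  shows "partial_deriv i (\<lambda>x. f x + g x) x = partial_deriv i f x + partial_deriv i g x"
  using partial_deriv_eq[OF has_derivative_add[OF has_derivative_frechet has_derivative_frechet], OF assms]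
  by (simp add: partial_deriv_def)

lemma partial_deriv_mult:
  fixes f g :: "real ^ 'n::finite \<Rightarrow> real"
  assumes "f differentiable (at x)" "g differentiable (at x)"
  shows "partial_deriv i (\<lambda>x. f x * g x) x = f x * partial_deriv i g x + partial_deriv i f x * g x"
  using partial_deriv_eq[OF has_derivative_mult[OF has_derivative_frechet has_derivative_frechet], OF assms]
  by (simp add: partial_deriv_def)

lemma partial_deriv_const: "partial_deriv i (\<lambda>x. c) x = 0"
  by (simp add: partial_deriv_eq[OF has_derivative_const])

lemma smooth_on_const:
  assumes "open S" shows "smooth_on S (\<lambda>x. c)"
  by (rule smooth_on_coinduct[where F = "range (\<lambda>c x. c)", OF assms])
     (auto simp: partial_deriv_const)

lemma smooth_on_add:
  assumes S: "open S" and "smooth_on S f" "smooth_on S g"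
  shows "smooth_on S (\<lambda>x. f x + g x)"
proof (rule smooth_on_coinduct[OF S])
  let ?F = "{\<lambda>x. f x + g x | f g. smooth_on S f \<and> smooth_on S g}"
  show "(\<lambda>x. f x + g x) \<in> ?F" using assms by blast
  show "h differentiable (at x)" if "h \<in> ?F" "x \<in> S" for h x
    using that by (auto intro!: differentiable_add intro: smooth_onD)
  show "\<exists>g\<in>?F. \<forall>x\<in>S. partial_deriv i h x = g x" if "h \<in> ?F" for h i
  proof -
    from that obtain f g where h: "h = (\<lambda>x. f x + g x)" "smooth_on S f" "smooth_on S g" by auto
    have "(\<lambda>x. partial_deriv i f x + partial_deriv i g x) \<in> ?F"
      using h smooth_on_partial_deriv by blast
    then show ?thesis unfolding h(1) using h
      by (intro bexI[rotated]) (auto intro!: partial_deriv_add smooth_onD)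
  qed
qed

text \<open>A family to feed into the coinduction. The product rule turns one product into a sum of
  two, so products alone are not closed under differentiation, but their finite sums are.\<close>

inductive_set smooth_products :: "(real ^ 'n::finite) set \<Rightarrow> (real ^ 'n \<Rightarrow> real) set"
  for S where
  prod: "smooth_on S f \<Longrightarrow> smooth_on S g \<Longrightarrow> (\<lambda>x. f x * g x) \<in> smooth_products S"
| add: "f \<in> smooth_products S \<Longrightarrow> g \<in> smooth_products S \<Longrightarrow> (\<lambda>x. f x + g x) \<in> smooth_products S"

lemma smooth_products_differentiable:
  "h \<in> smooth_products S \<Longrightarrow> x \<in> S \<Longrightarrow> h differentiable (at x)"
  by (induction rule: smooth_products.induct) (auto intro!: differentiable_mult intro: smooth_onD)

lemma smooth_products_partial_deriv:
  "h \<in> smooth_products S \<Longrightarrow> \<exists>g\<in>smooth_products S. \<forall>x\<in>S. partial_deriv i h x = g x"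
proof (induction rule: smooth_products.induct)
  case (prod f g)
  have "(\<lambda>x. f x * partial_deriv i g x + partial_deriv i f x * g x) \<in> smooth_products S"
    using prod by (intro smooth_products.intros smooth_on_partial_deriv)
  then show ?case using prod
    by (intro bexI[rotated]) (auto intro!: partial_deriv_mult smooth_onD)
next
  case (add f g)
  then obtain f' g' where "f' \<in> smooth_products S" "g' \<in> smooth_products S"
    "\<forall>x\<in>S. partial_deriv i f x = f' x" "\<forall>x\<in>S. partial_deriv i g x = g' x" by blast
  then show ?case using add(1,2)
    by (intro bexI[of _ "\<lambda>x. f' x + g' x"])
       (auto simp: partial_deriv_add smooth_products_differentiable intro: smooth_products.add)
qed

lemma smooth_on_mult:
  assumes "open S" "smooth_on S f" "smooth_on S g"
  shows "smooth_on S (\<lambda>x. f x * g x)"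
  by (rule smooth_on_coinduct[OF assms(1) smooth_products.prod[OF assms(2,3)]])
     (auto intro: smooth_products_differentiable smooth_products_partial_deriv)

lemma smooth_on_cmult: "open S \<Longrightarrow> smooth_on S f \<Longrightarrow> smooth_on S (\<lambda>x. c * f x)"
  by (intro smooth_on_mult smooth_on_const)

lemma smooth_on_prod:
  assumes "open S" "\<And>a. a \<in> A \<Longrightarrow> smooth_on S (f a)"
  shows "smooth_on S (\<lambda>x. \<Prod>a\<in>A. f a x)"
  using assms(2) by (induction A rule: infinite_finite_induct)
    (auto intro!: smooth_on_mult smooth_on_const assms(1))

lemma partial_deriv_affine:
  assumes "f differentiable (at (s *\<^sub>R x + b))"
  shows "partial_deriv i (\<lambda>x. f (s *\<^sub>R x + b)) x = s * partial_deriv i f (s *\<^sub>R x + b)"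
    "(\<lambda>x. f (s *\<^sub>R x + b)) differentiable (at x)"
proof -
  let ?D = "frechet_derivative f (at (s *\<^sub>R x + b))"
  have "((\<lambda>x. s *\<^sub>R x + b) has_derivative (\<lambda>h. s *\<^sub>R h)) (at x)"
    by (auto intro!: derivative_eq_intros)
  from has_derivative_compose[OF this has_derivative_frechet[OF assms]]
  have D: "((\<lambda>x. f (s *\<^sub>R x + b)) has_derivative (\<lambda>h. ?D (s *\<^sub>R h))) (at x)" .
  then show "(\<lambda>x. f (s *\<^sub>R x + b)) differentiable (at x)" unfolding differentiable_def by blast
  show "partial_deriv i (\<lambda>x. f (s *\<^sub>R x + b)) x = s * partial_deriv i f (s *\<^sub>R x + b)"
    using partial_deriv_eq[OF D] linear_cmul[OF linear_frechet_derivative[OF assms]]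
    by (simp add: partial_deriv_def)
qed

lemma iter_deriv_affine:
  assumes "smooth_on UNIV f"
  shows "iter_deriv J (\<lambda>x. f (s *\<^sub>R x + b)) = (\<lambda>x. s ^ length J * iter_deriv J f (s *\<^sub>R x + b))"
proof (induction J)
  case (Cons i J)
  have d: "iter_deriv J f differentiable (at y)" for y
    using assms unfolding smooth_on_def by blast
  show ?case unfolding iter_deriv.simps Cons.IH
    by (auto simp: partial_deriv_mult partial_deriv_affine[OF d] partial_deriv_const)
qed simp

lemma smooth_on_affine:
  assumes "smooth_on UNIV f"
  shows "smooth_on UNIV (\<lambda>x. f (s *\<^sub>R x + b))"
  using assms unfolding smooth_on_def iter_deriv_affine[OF assms]
  by (auto intro!: differentiable_mult partial_deriv_affine(2))

section \<open>A smooth function on the line that vanishes on a half-line\<close>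

definition flat_exp :: "real poly \<Rightarrow> real \<Rightarrow> real" where
  "flat_exp P t = (if t > 0 then poly P (1 / t) * exp (- 1 / t) else 0)"

lemma poly_exp_tendsto_0: "((\<lambda>s. poly P s * exp (- s)) \<longlongrightarrow> (0::real)) at_top"
proof -
  have "((\<lambda>s. \<Sum>i\<le>degree P. coeff P i * (s ^ i / exp s)) \<longlongrightarrow> (\<Sum>i\<le>degree P. coeff P i * 0)) at_top"
    by (intro tendsto_intros tendsto_power_div_exp_0)
  then show ?thesis
    by (simp add: poly_altdef exp_minus divide_inverse sum_distrib_right mult.assoc)
qed

text \<open>The polynomial parameter is there to make the family closed under differentiation. With
  s = 1/t the chain rule gives ds/dt = -s^2, so P(s) exp(-s) becomes s^2 (P - P')(s) exp(-s), and
  \<open>[:0,0,1:]\<close> is s^2.\<close>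

lemma flat_exp_has_derivative:
  "(flat_exp P has_real_derivative flat_exp ([:0,0,1:] * (P - pderiv P)) t) (at t)"
proof (cases t "0::real" rule: linorder_cases)
  case less
  then have "((\<lambda>_. 0) has_real_derivative 0) (at t)" by simp
  then have "(flat_exp P has_real_derivative 0) (at t)"
    by (rule has_field_derivative_transform_within_open[where S = "{..<0}"])
       (use less in \<open>auto simp: flat_exp_def\<close>)
  then show ?thesis using less by (simp add: flat_exp_def)
next
  case greater
  have "((\<lambda>t. poly P (1 / t) * exp (- 1 / t)) has_real_derivative
      flat_exp ([:0,0,1:] * (P - pderiv P)) t) (at t)"
    using greater by (auto intro!: derivative_eq_intros DERIV_chain'[OF _ poly_DERIV] simp: flat_exp_def)
      (simp add: field_simps power2_eq_square)
  then show ?thesis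
    by (rule has_field_derivative_transform_within_open[where S = "{0<..}"])
       (use greater in \<open>auto simp: flat_exp_def\<close>)
next
  case equal
  \<comment> \<open>Dividing by \<open>h\<close> multiplies P(1/h) by another factor 1/h, which
    \<open>[:0,1:]\<close> absorbs; exponential decay in 1/h then beats the polynomial.\<close>
  have "((\<lambda>h. poly ([:0,1:] * P) (inverse h) * exp (- inverse h)) \<longlongrightarrow> 0) (at_right 0)"
    by (rule filterlim_compose[OF poly_exp_tendsto_0 filterlim_inverse_at_top_right])
  then have "((\<lambda>h. flat_exp P h / h) \<longlongrightarrow> 0) (at_right 0)"
    by (rule Lim_transform_eventually)
       (auto simp: flat_exp_def eventually_at_filter field_simps)
  moreover have "((\<lambda>h. flat_exp P h / h) \<longlongrightarrow> 0) (at_left 0)"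
    by (rule Lim_transform_eventually[of "\<lambda>_. 0"])
       (auto simp: flat_exp_def eventually_at_filter)
  ultimately have "((\<lambda>h. flat_exp P h / h) \<longlongrightarrow> 0) (at 0)"
    using filterlim_split_at_real by blast
  then show ?thesis unfolding equal by (simp add: DERIV_def flat_exp_def)
qed

text \<open>Slopes 1 and -1 will describe the two opposite faces of a box. In the proof the constant
  \<open>c\<close> of the family collects the chain rule factors, which are 0 in all directions
  except \<open>k\<close>.\<close>

lemma smooth_on_flat_exp: "smooth_on UNIV (\<lambda>x. flat_exp P (a + s * x $ k))"
proof (rule smooth_on_coinduct[OF open_UNIV])
  let ?F = "{\<lambda>x::real^'a. c * flat_exp P (a + s * x $ k) | c P. True}"
  show "(\<lambda>x. flat_exp P (a + s * x $ k)) \<in> ?F"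
    by (auto intro!: exI[of _ 1] exI[of _ P])
  have D: "((\<lambda>x::real^'a. c * flat_exp P (a + s * x $ k)) has_derivative
      (\<lambda>h. c * (flat_exp ([:0,0,1:] * (P - pderiv P)) (a + s * x $ k) * (s * h $ k)))) (at x)" for c P x
    by (rule has_derivative_mult_right has_derivative_compose[OF _
          flat_exp_has_derivative[unfolded has_field_derivative_def], where f = "\<lambda>x. a + s * x $ k"])+
       (auto intro!: derivative_eq_intros bounded_linear_imp_has_derivative bounded_linear_vec_nth)
  show "h differentiable (at x)" if "h \<in> ?F" for h x
    using that D unfolding differentiable_def by blast
  show "\<exists>g\<in>?F. \<forall>x\<in>UNIV. partial_deriv i h x = g x" if "h \<in> ?F" for h i
  proof -
    obtain c P where h: "h = (\<lambda>x. c * flat_exp P (a + s * x $ k))" using \<open>h \<in> ?F\<close> by blast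
    have "partial_deriv i h x = (c * (s * axis i 1 $ k)) * flat_exp ([:0,0,1:] * (P - pderiv P)) (a + s * x $ k)" for x
      unfolding h partial_deriv_eq[OF D] by (simp add: mult_ac)
    then show ?thesis by blast
  qed
qed

subsection \<open>Test functions and the formal adjoint\<close>

lemma Q_eq_box: "Q = box 0 (1 :: real ^ 'n::finite)"
  by (auto simp: Q_def mem_box_cart)

lemma open_Q: "open Q" and convex_Q: "convex Q" and bounded_Q: "bounded Q"
  and sets_Q [measurable]: "Q \<in> sets borel"
  by (auto simp: Q_eq_box)

lemma mem_Q_dilation:
  assumes "x \<in> Q" "z \<in> Q" "0 \<le> t" "t \<le> 1"
  shows "t *\<^sub>R x + (1 - t) *\<^sub>R z \<in> Q"
  using convexD[OF convex_Q assms(1,2)] assms by auto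

section \<open>Integrals over the cube and affine substitution\<close>

lemma integral_on_Q:
  fixes f :: "real ^ 'n::finite \<Rightarrow> real"
  assumes [measurable]: "f \<in> borel_measurable borel"
  shows "(LINT x|lebesgue_on Q. f x) = (LINT x|lborel. indicator Q x * f x)"
    and "integrable (lebesgue_on Q) f \<longleftrightarrow> integrable lborel (\<lambda>x. indicator Q x * f x)"
  by (auto simp: integral_restrict_space integrable_restrict_space
      integral_completion integrable_completion)

lemma integral_on_Q_vanishing:
  fixes f :: "real ^ 'n::finite \<Rightarrow> real"
  assumes "f \<in> borel_measurable borel" "\<And>x. x \<notin> Q \<Longrightarrow> f x = 0"
  shows "(LINT x|lebesgue_on Q. f x) = (LINT x|lborel. f x)"
proof -
  have "(\<lambda>x. indicator Q x * f x) = f" using assms(2) by (intro ext) (auto simp: indicator_def)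
  then show ?thesis using integral_on_Q(1)[OF assms(1)] by simp
qed

lemma lborel_integral_affine:
  fixes f :: "'a::euclidean_space \<Rightarrow> real"
  assumes [measurable]: "f \<in> borel_measurable borel" and "c \<noteq> 0"
  shows "(LINT x|lborel. f (b + c *\<^sub>R x)) = (LINT x|lborel. f x) / \<bar>c\<bar> ^ DIM('a)"
proof -
  have "(LINT x|lborel. f x) = \<bar>c\<bar> ^ DIM('a) * (LINT x|lborel. f (b + c *\<^sub>R x))"
    by (subst lborel_affine[OF assms(2), of b])
       (simp add: integral_density integral_distr ennreal_power)
  then show ?thesis using assms(2) by simp
qed

lemma nn_integral_lborel_affine:
  fixes f :: "'a::euclidean_space \<Rightarrow> ennreal"
  assumes [measurable]: "f \<in> borel_measurable borel" and "c \<noteq> 0"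
  shows "(\<integral>\<^sup>+x. f (b + c *\<^sub>R x) \<partial>lborel) = ennreal (1 / \<bar>c\<bar> ^ DIM('a)) * (\<integral>\<^sup>+x. f x \<partial>lborel)"
proof -
  have "(\<integral>\<^sup>+x. f x \<partial>lborel) = ennreal (\<bar>c\<bar> ^ DIM('a)) * (\<integral>\<^sup>+x. f (b + c *\<^sub>R x) \<partial>lborel)"
    by (subst lborel_affine[OF assms(2), of b])
       (simp add: nn_integral_density nn_integral_distr nn_integral_cmult ennreal_power)
  then have "ennreal (1 / \<bar>c\<bar> ^ DIM('a)) * (\<integral>\<^sup>+x. f x \<partial>lborel) =
      ennreal (1 / \<bar>c\<bar> ^ DIM('a) * \<bar>c\<bar> ^ DIM('a)) * (\<integral>\<^sup>+x. f (b + c *\<^sub>R x) \<partial>lborel)"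
    by (subst ennreal_mult) (auto simp: mult.assoc)
  then show ?thesis using assms(2) by simp
qed

text \<open>Any compact set in \<open>Q\<close> may witness the support. This suits sums and
  dilations, where a union or an image is at hand but the exact closure of the nonzero set is
  not.\<close>

lemma test_fun_iff:
  "test_fun f \<longleftrightarrow> smooth_on UNIV f \<and> (\<exists>K. compact K \<and> K \<subseteq> Q \<and> (\<forall>x. x \<notin> K \<longrightarrow> f x = 0))"
proof
  assume "test_fun f"
  then show "smooth_on UNIV f \<and> (\<exists>K. compact K \<and> K \<subseteq> Q \<and> (\<forall>x. x \<notin> K \<longrightarrow> f x = 0))"
    unfolding test_fun_def using closure_subset[of "{x. f x \<noteq> 0}"] by blast
next
  assume "smooth_on UNIV f \<and> (\<exists>K. compact K \<and> K \<subseteq> Q \<and> (\<forall>x. x \<notin> K \<longrightarrow> f x = 0))"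
  then obtain K where f: "smooth_on UNIV f" and K: "compact K" "K \<subseteq> Q" "\<forall>x. x \<notin> K \<longrightarrow> f x = 0" by blast
  have "closure {x. f x \<noteq> 0} \<subseteq> K"
    by (rule closure_minimal) (use K compact_imp_closed in auto)
  moreover have "compact (closure {x. f x \<noteq> 0})"
    using calculation K(1) closed_closure compact_Int_closed by (metis inf.absorb2)
  ultimately show "test_fun f" unfolding test_fun_def using f K by auto
qed

lemma test_fun_smooth: "test_fun f \<Longrightarrow> smooth_on UNIV f"
  by (simp add: test_fun_def)

lemma test_fun_support:
  assumes "test_fun f"
  obtains K where "compact K" "K \<subseteq> Q" "\<And>x. x \<notin> K \<Longrightarrow> f x = 0"
  using assms unfolding test_fun_iff by blast

lemma test_fun_outside: "test_fun f \<Longrightarrow> x \<notin> Q \<Longrightarrow> f x = 0"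
  by (meson subsetD test_fun_support)

lemma test_fun_differentiable: "test_fun f \<Longrightarrow> f differentiable (at x)"
  using smooth_onD test_fun_smooth by blast

lemma test_fun_continuous: "test_fun f \<Longrightarrow> continuous_on S f"
  using smooth_on_continuous test_fun_smooth continuous_on_subset by blast

lemma test_fun_measurable: "test_fun f \<Longrightarrow> f \<in> borel_measurable borel"
  using test_fun_continuous borel_measurable_continuous_onI by blast

lemma partial_deriv_outside:
  assumes "closed K" "\<And>x. x \<notin> K \<Longrightarrow> f x = 0" "x \<notin> K"
  shows "partial_deriv i f x = 0"
  using partial_deriv_cong[of "- K" x f "\<lambda>_. 0" i] assms
  by (simp add: partial_deriv_const open_Compl)

lemma test_fun_partial_deriv:
  assumes "test_fun f" shows "test_fun (partial_deriv i f)"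
proof -
  obtain K where "compact K" "K \<subseteq> Q" "\<And>x. x \<notin> K \<Longrightarrow> f x = 0"
    using test_fun_support[OF assms] by metis
  then show ?thesis unfolding test_fun_iff
    using partial_deriv_outside compact_imp_closed smooth_on_partial_deriv test_fun_smooth[OF assms] by metis
qed

lemma test_fun_iter_deriv: "test_fun f \<Longrightarrow> test_fun (iter_deriv J f)"
  by (induction J) (auto intro: test_fun_partial_deriv)

lemma test_fun_cmult: "test_fun f \<Longrightarrow> test_fun (\<lambda>x. c * f x)"
  unfolding test_fun_iff by (metis smooth_on_cmult[OF open_UNIV] mult_zero_right)

lemma test_fun_zero: "test_fun (\<lambda>x. 0)"
  unfolding test_fun_iff by (auto intro!: smooth_on_const exI[of _ "{}"])

lemma test_fun_add: "test_fun f \<Longrightarrow> test_fun g \<Longrightarrow> test_fun (\<lambda>x. f x + g x)"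
proof -
  assume a: "test_fun f" "test_fun g"
  obtain K L where "compact K" "K \<subseteq> Q" "\<And>x. x \<notin> K \<Longrightarrow> f x = 0"
    "compact L" "L \<subseteq> Q" "\<And>x. x \<notin> L \<Longrightarrow> g x = 0"
    using a test_fun_support by metis
  then show "test_fun (\<lambda>x. f x + g x)" unfolding test_fun_iff
    using smooth_on_add[OF open_UNIV test_fun_smooth test_fun_smooth, OF a]
    by (intro conjI exI[of _ "K \<union> L"]) auto
qed

lemma test_fun_sum: "(\<And>a. a \<in> A \<Longrightarrow> test_fun (f a)) \<Longrightarrow> test_fun (\<lambda>x. \<Sum>a\<in>A. f a x)"
  by (induction A rule: infinite_finite_induct) (auto intro: test_fun_zero test_fun_add)

lemma test_fun_bounded:
  assumes "test_fun f" obtains M where "\<And>x. \<bar>f x\<bar> \<le> M" "0 \<le> M"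
proof -
  obtain K where K: "compact K" "K \<subseteq> Q" "\<And>x. x \<notin> K \<Longrightarrow> f x = 0"
    using test_fun_support[OF assms] by metis
  have "bounded (f ` K)"
    by (intro compact_imp_bounded compact_continuous_image test_fun_continuous assms K)
  then obtain M where M: "\<And>x. x \<in> K \<Longrightarrow> \<bar>f x\<bar> \<le> M" unfolding bounded_iff by auto
  have "\<bar>f x\<bar> \<le> max M 0" for x
  proof (cases "x \<in> K")
    case True
    show ?thesis using M[OF True] by simp
  next
    case False
    show ?thesis using K(3)[OF False] by simp
  qed
  then show thesis by (rule that) simp
qed

section \<open>Compactly supported integrands and integration by parts\<close>

lemma integrable_compact_support:
  fixes f :: "real ^ 'n::finite \<Rightarrow> real"
  assumes "compact K" "continuous_on K f" "\<And>x. x \<notin> K \<Longrightarrow> f x = 0"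
  shows "integrable lborel f"
proof -
  have "(\<lambda>x. indicator K x *\<^sub>R f x) = f" using assms(3) by (intro ext) (auto simp: indicator_def)
  then show ?thesis using borel_integrable_compact[OF assms(1,2)] by simp
qed

lemma test_fun_integrable: "test_fun f \<Longrightarrow> integrable lborel f"
  by (metis integrable_compact_support test_fun_continuous test_fun_support)

text \<open>The values of \<open>g\<close> off \<open>Q\<close> are arbitrary. The product is still
  continuous everywhere because \<open>Q\<close> and the complement of the compact support
  \<open>K\<close> are open and cover the space, and on the latter the product is 0.\<close>

lemma test_fun_mult_continuous:
  assumes f: "test_fun f" and g: "continuous_on Q g"
  shows "continuous_on UNIV (\<lambda>x. f x * g x)" "integrable lborel (\<lambda>x. f x * g x)"
proof -
  obtain K where K: "compact K" "K \<subseteq> Q" "\<And>x. x \<notin> K \<Longrightarrow> f x = 0"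
    using test_fun_support[OF f] by metis
  have "continuous_on (Q \<union> - K) (\<lambda>x. f x * g x)"
  proof (rule continuous_on_open_Un)
    show "continuous_on Q (\<lambda>x. f x * g x)"
      by (intro continuous_intros g test_fun_continuous f)
    have "continuous_on (- K) (\<lambda>x. 0::real)" by simp
    then show "continuous_on (- K) (\<lambda>x. f x * g x)"
      by (rule continuous_on_eq) (use K in auto)
  qed (use open_Q K compact_imp_closed in auto)
  moreover have "Q \<union> - K = UNIV" using K(2) by blast
  ultimately show *: "continuous_on UNIV (\<lambda>x. f x * g x)" by simp
  show "integrable lborel (\<lambda>x. f x * g x)"
    by (rule integrable_compact_support[OF K(1) continuous_on_subset[OF * subset_UNIV]]) (simp add: K(3))
qed

text \<open>By translation invariance every difference quotient of \<open>f\<close> in direction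
  \<open>i\<close> has integral 0. The quotients converge to the partial derivative and are
  dominated through the mean value theorem.\<close>

lemma integral_partial_deriv_eq_0:
  fixes f :: "real ^ 'n::finite \<Rightarrow> real"
  assumes diff: "\<And>x. f differentiable (at x)" and cont: "continuous_on UNIV (partial_deriv i f)"
    and K: "compact K" "\<And>x. x \<notin> K \<Longrightarrow> f x = 0"
  shows "(LINT x|lborel. partial_deriv i f x) = 0"
proof -
  let ?e = "axis i (1::real)"
  have cf: "continuous_on UNIV f"
    using diff by (meson continuous_at_imp_continuous_on differentiable_imp_continuous_within)
  have mf [measurable]: "f \<in> borel_measurable borel" and md: "partial_deriv i f \<in> borel_measurable borel"
    using cf cont borel_measurable_continuous_onI by blast+
  have fi: "integrable lborel f"
    by (rule integrable_compact_support[OF K(1) continuous_on_subset[OF cf subset_UNIV] K(2)])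
  obtain M0 where M0: "\<And>x. x \<in> K \<Longrightarrow> \<bar>partial_deriv i f x\<bar> \<le> M0"
    using compact_imp_bounded[OF compact_continuous_image[OF continuous_on_subset[OF cont subset_UNIV] K(1)]]
    unfolding bounded_iff by auto
  define M where "M = max M0 0"
  have M: "\<bar>partial_deriv i f x\<bar> \<le> M" for x
    using M0[of x] partial_deriv_outside[OF compact_imp_closed[OF K(1)] K(2), where x = x and i = i]
    unfolding M_def by (cases "x \<in> K") force+
  obtain R where R: "\<And>x. x \<in> K \<Longrightarrow> norm x \<le> R"
    using compact_imp_bounded[OF K(1)] unfolding bounded_iff by auto
  have line: "((\<lambda>t. f (x + t *\<^sub>R ?e)) has_real_derivative partial_deriv i f (x + t *\<^sub>R ?e)) (at t)" for x t
  proof -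
    let ?D = "frechet_derivative f (at (x + t *\<^sub>R ?e))"
    have "((\<lambda>t. x + t *\<^sub>R ?e) has_derivative (\<lambda>h. h *\<^sub>R ?e)) (at t)"
      by (auto intro!: derivative_eq_intros)
    from has_derivative_compose[OF this has_derivative_frechet[OF diff]]
    show ?thesis unfolding has_field_derivative_def partial_deriv_def
      using linear_cmul[OF linear_frechet_derivative[OF diff]]
      by (simp add: mult_commute_abs)
  qed
  \<comment> \<open>Steps of length at most 1: every quotient then vanishes outside the ball of
    radius \<open>R + 1\<close>, which carries the dominating function.\<close>
  define s where "s n = 1 / real (Suc n)" for n
  have s: "0 < s n" "s n \<le> 1" for n by (auto simp: s_def)
  define q where "q n x = (f (x + s n *\<^sub>R ?e) - f x) / s n" for n x
  have "(\<lambda>n. LINT x|lborel. q n x) \<longlonglongrightarrow> (LINT x|lborel. partial_deriv i f x)"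
  proof (rule integral_dominated_convergence[where w = "\<lambda>x. indicator (cball 0 (R + 1)) x * M"])
    show "partial_deriv i f \<in> borel_measurable lborel" using md by simp
    show "q n \<in> borel_measurable lborel" for n unfolding q_def[abs_def] by measurable
    show "integrable lborel (\<lambda>x::real^'n. indicator (cball 0 (R + 1)) x * M)"
      by (auto intro!: integrable_mult_left emeasure_compact_finite)
    have "(\<lambda>n. q n x) \<longlonglongrightarrow> partial_deriv i f x" for x
    proof -
      have "((\<lambda>h. (f (x + h *\<^sub>R ?e) - f x) / h) \<longlongrightarrow> partial_deriv i f x) (at 0)"
        using line[of x 0] by (simp add: DERIV_def)
      moreover have "filterlim s (at 0) sequentially"
        unfolding filterlim_at using s(1) lim_inverse_n' LIMSEQ_Suc[OF lim_inverse_n']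
        by (auto simp: s_def[abs_def] less_imp_neq)
      ultimately show ?thesis unfolding q_def by (rule filterlim_compose)
    qed
    then show "AE x in lborel. (\<lambda>n. q n x) \<longlonglongrightarrow> partial_deriv i f x" by simp
    have "norm (q n x) \<le> indicator (cball 0 (R + 1)) x * M" for n x
    proof (cases "x \<in> cball 0 (R + 1)")
      case True
      have "norm (f (x + s n *\<^sub>R ?e) - f (x + 0 *\<^sub>R ?e)) \<le> M * norm (s n - 0)"
        by (rule field_differentiable_bound[where S = UNIV]) (use line M in auto)
      then show ?thesis using True s[of n] by (simp add: q_def abs_mult divide_simps)
    next
      case False
      have "norm x \<le> norm (x + s n *\<^sub>R ?e) + norm (s n *\<^sub>R ?e)"
        using norm_triangle_ineq4[of "x + s n *\<^sub>R ?e" "s n *\<^sub>R ?e"] by simp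
      also have "norm (s n *\<^sub>R ?e) \<le> 1" using s[of n] by (simp add: norm_axis_1)
      finally have "x + s n *\<^sub>R ?e \<notin> K" "x \<notin> K" using False R by fastforce+
      then show ?thesis using K(2) False by (simp add: q_def)
    qed
    then show "AE x in lborel. norm (q n x) \<le> indicator (cball 0 (R + 1)) x * M" for n by simp
  qed
  moreover have "(LINT x|lborel. q n x) = 0" for n
  proof -
    have *: "(\<lambda>x. f (x + s n *\<^sub>R ?e)) = (\<lambda>x. f (s n *\<^sub>R ?e + 1 *\<^sub>R x))" by (simp add: add.commute)
    have "(LINT x|lborel. f (x + s n *\<^sub>R ?e)) = (LINT x|lborel. f x)"
      unfolding * by (subst lborel_integral_affine) auto
    moreover have "integrable lborel (\<lambda>x. f (x + s n *\<^sub>R ?e))"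
    proof (rule integrable_compact_support)
      show "compact ((\<lambda>x. x - s n *\<^sub>R ?e) ` K)" using K(1) compact_translation_subtract by blast
      show "f (x + s n *\<^sub>R ?e) = 0" if "x \<notin> (\<lambda>x. x - s n *\<^sub>R ?e) ` K" for x
        using that K(2) by (metis add_diff_cancel_right' image_eqI)
    qed (intro continuous_intros continuous_on_compose2[OF cf]; simp)
    ultimately show ?thesis unfolding q_def using fi by simp
  qed
  ultimately show ?thesis by (simp add: LIMSEQ_const_iff)
qed

text \<open>The product \<open>f x * g x\<close> is differentiable everywhere although
  \<open>g\<close> is smooth only in \<open>Q\<close>: off the support of \<open>f\<close> it is
  locally 0. Its partial derivative therefore has integral 0.\<close>

lemma integration_by_parts:
  assumes f: "test_fun f" and g: "smooth_on Q g"
  shows "(LINT x|lborel. f x * partial_deriv i g x) = - (LINT x|lborel. partial_deriv i f x * g x)"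
proof -
  obtain K where K: "compact K" "K \<subseteq> Q" "\<And>x. x \<notin> K \<Longrightarrow> f x = 0"
    using test_fun_support[OF f] by metis
  let ?w = "\<lambda>x. f x * g x"
  note cg = smooth_on_continuous[OF g] smooth_on_continuous[OF smooth_on_partial_deriv[OF g]]
  note df = test_fun_partial_deriv[OF f]
  have w0: "?w x = 0" if "x \<notin> K" for x using K(3) that by simp
  have dw: "?w differentiable (at x)" for x
  proof (cases "x \<in> K")
    case True
    then show ?thesis using K(2) g smooth_onD test_fun_differentiable[OF f]
      by (intro differentiable_mult) auto
  next
    case False
    show ?thesis
      by (rule differentiable_cong_open[of "- K" x "\<lambda>_. 0"])
         (use False w0 K compact_imp_closed in auto)
  qed
  have pw: "partial_deriv i ?w = (\<lambda>x. f x * partial_deriv i g x + partial_deriv i f x * g x)"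
  proof
    fix x
    show "partial_deriv i ?w x = f x * partial_deriv i g x + partial_deriv i f x * g x"
    proof (cases "x \<in> K")
      case True
      then show ?thesis using K(2) g smooth_onD test_fun_differentiable[OF f]
        by (intro partial_deriv_mult) auto
    next
      case False
      then show ?thesis
        using partial_deriv_outside[OF compact_imp_closed[OF K(1)]] w0 K(3) by simp
    qed
  qed
  have "(LINT x|lborel. partial_deriv i ?w x) = 0"
  proof (rule integral_partial_deriv_eq_0[OF dw _ K(1) w0])
    show "continuous_on UNIV (partial_deriv i ?w)" unfolding pw
      by (intro continuous_on_add test_fun_mult_continuous(1) f df cg)
  qed
  then show ?thesis unfolding pw
    using test_fun_mult_continuous(2)[OF f cg(2)] test_fun_mult_continuous(2)[OF df cg(1)] by simp
qed

text \<open>The outermost derivative of \<open>u\<close> is moved first and thus ends up innermost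
  on \<open>f\<close>; this is the origin of \<open>rev J\<close>.\<close>

lemma integration_by_parts_iter:
  assumes "test_fun f" "smooth_on Q u"
  shows "(LINT x|lborel. f x * iter_deriv J u x) =
    (-1) ^ length J * (LINT x|lborel. iter_deriv (rev J) f x * u x)"
  using assms
proof (induction J arbitrary: f)
  case (Cons i J)
  have "(LINT x|lborel. f x * iter_deriv (i # J) u x) = - (LINT x|lborel. partial_deriv i f x * iter_deriv J u x)"
    using integration_by_parts[OF Cons.prems(1) smooth_on_iter_deriv[OF Cons.prems(2)]] by simp
  also have "\<dots> = - ((-1) ^ length J * (LINT x|lborel. iter_deriv (rev J) (partial_deriv i f) x * u x))"
    using Cons.IH[OF test_fun_partial_deriv Cons.prems(2)] Cons.prems(1) by simp
  finally show ?case by (simp add: iter_deriv_append)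
qed simp

section \<open>The formal adjoint in closed form\<close>

definition adjoint_formula ::
    "nat \<Rightarrow> 'n::finite diff_op \<Rightarrow> ('n list \<Rightarrow> real ^ 'n \<Rightarrow> real) \<Rightarrow> real ^ 'n \<Rightarrow> real" where
  "adjoint_formula d B \<phi> x = (\<Sum>I\<in>coords d. \<Sum>J\<in>words (length I).
     B (length I) I J * ((-1) ^ length J * iter_deriv (rev J) (\<phi> I) x))"

lemma test_fun_adjoint_formula:
  "test_field d \<phi> \<Longrightarrow> test_fun (adjoint_formula d B \<phi>)"
  unfolding adjoint_formula_def[abs_def] test_field_def
  by (intro test_fun_sum test_fun_cmult test_fun_iter_deriv) auto

text \<open>\<open>adjoint_formula\<close> applies the transposed blocks of \<open>B\<close>: each
  entry keeps its coefficient, and moving the derivatives of the word \<open>J\<close> onto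
  \<open>\<phi> I\<close> yields the sign and the reversed word. Both sides are expanded into finite
  sums so that this can be done entry by entry.\<close>

lemma adjoint_formula_adjoint:
  assumes \<phi>: "test_field d \<phi>" and u: "smooth_on Q u"
  shows "(LINT x|lebesgue_on Q. u x * adjoint_formula d B \<phi> x) =
    (LINT x|lebesgue_on Q. (\<Sum>I\<in>coords d. \<phi> I x * apply_op B u I x))"
proof -
  have cu: "continuous_on Q (iter_deriv J u)" for J
    using u smooth_on_continuous smooth_on_iter_deriv by blast
  have t: "test_fun (\<phi> I)" if "I \<in> coords d" for I using \<phi> that by (simp add: test_field_def)
  have i1: "integrable lborel (\<lambda>x. \<phi> I x * iter_deriv J u x)" if "I \<in> coords d" for I J
    using test_fun_mult_continuous(2)[OF t cu] that by blast
  have i2: "integrable lborel (\<lambda>x. iter_deriv (rev J) (\<phi> I) x * u x)" if "I \<in> coords d" for I J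
    using test_fun_mult_continuous(2)[OF test_fun_iter_deriv[OF t] cu[of "[]"]] that by simp
  have e1: "(\<Sum>I\<in>coords d. \<phi> I x * apply_op B u I x) =
      (\<Sum>I\<in>coords d. \<Sum>J\<in>words (length I). B (length I) I J * (\<phi> I x * iter_deriv J u x))" for x
    by (simp add: apply_op_def sum_distrib_left mult_ac)
  have e2: "u x * adjoint_formula d B \<phi> x = (\<Sum>I\<in>coords d. \<Sum>J\<in>words (length I).
      B (length I) I J * ((-1) ^ length J * (iter_deriv (rev J) (\<phi> I) x * u x)))" for x
    by (simp add: adjoint_formula_def sum_distrib_left mult_ac)
  have m1: "integrable lborel (\<lambda>x. \<Sum>I\<in>coords d. \<phi> I x * apply_op B u I x)"
    unfolding e1 by (intro Bochner_Integration.integrable_sum integrable_mult_right i1)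
  have m2: "integrable lborel (\<lambda>x. u x * adjoint_formula d B \<phi> x)"
    unfolding e2 by (intro Bochner_Integration.integrable_sum integrable_mult_right i2)
  have "(LINT x|lebesgue_on Q. u x * adjoint_formula d B \<phi> x) = (LINT x|lborel. u x * adjoint_formula d B \<phi> x)"
    using borel_measurable_integrable[OF m2] test_fun_outside[OF test_fun_adjoint_formula[OF \<phi>]]
    by (intro integral_on_Q_vanishing) auto
  also have "\<dots> = (\<Sum>I\<in>coords d. \<Sum>J\<in>words (length I).
      B (length I) I J * ((-1) ^ length J * (LINT x|lborel. iter_deriv (rev J) (\<phi> I) x * u x)))"
    unfolding e2 by (simp add: i2)
  also have "\<dots> = (\<Sum>I\<in>coords d. \<Sum>J\<in>words (length I).
      B (length I) I J * (LINT x|lborel. \<phi> I x * iter_deriv J u x))"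
    by (simp add: integration_by_parts_iter[OF t u])
  also have "\<dots> = (LINT x|lborel. (\<Sum>I\<in>coords d. \<phi> I x * apply_op B u I x))"
    unfolding e1 by (simp add: i1)
  also have "\<dots> = (LINT x|lebesgue_on Q. (\<Sum>I\<in>coords d. \<phi> I x * apply_op B u I x))"
    using borel_measurable_integrable[OF m1] test_fun_outside[OF t]
    by (intro integral_on_Q_vanishing[symmetric]) auto
  finally show ?thesis .
qed

text \<open>The set where \<open>f\<close> is nonzero is null and, by continuity, open, hence empty.
  Besides the uniqueness of the adjoint, this shows that a bump function has nonzero
  integral.\<close>

lemma test_fun_eq_0:
  assumes f: "test_fun f" and 0: "(LINT x|lborel. f x * f x) = 0"
  shows "f x = 0"
proof -
  have "AE x in lborel. f x * f x = 0"
    using 0 integral_nonneg_eq_0_iff_AE[OF test_fun_mult_continuous(2)[OF f test_fun_continuous[OF f]]] by simp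
  then have ae: "AE x in lborel. x \<notin> {x. f x \<noteq> 0}" by simp
  have op: "open {x. f x \<noteq> 0}"
    using test_fun_continuous[OF f] by (simp add: open_Collect_neq)
  then have "{x. f x \<noteq> 0} \<in> null_sets lborel" using iffD2[OF AE_iff_null_sets ae] by simp
  then have "negligible {x. f x \<noteq> 0}"
    by (simp add: negligible_iff_null_sets null_sets_completionI)
  then show ?thesis using op open_not_negligible by blast
qed

lemma formal_adjoint_eq:
  assumes \<phi>: "test_field d \<phi>"
  shows "formal_adjoint d B \<phi> = adjoint_formula d B \<phi>"
  unfolding formal_adjoint_def
proof (rule the_equality)
  show "test_fun (adjoint_formula d B \<phi>) \<and> (\<forall>u. smooth_on Q u \<longrightarrow>
      (LINT x|lebesgue_on Q. u x * adjoint_formula d B \<phi> x) =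
      (LINT x|lebesgue_on Q. (\<Sum>I\<in>coords d. \<phi> I x * apply_op B u I x)))"
    using test_fun_adjoint_formula adjoint_formula_adjoint \<phi> by blast
  fix \<psi>
  assume a: "test_fun \<psi> \<and> (\<forall>u. smooth_on Q u \<longrightarrow>
      (LINT x|lebesgue_on Q. u x * \<psi> x) =
      (LINT x|lebesgue_on Q. (\<Sum>I\<in>coords d. \<phi> I x * apply_op B u I x)))"
  \<comment> \<open>The difference of the two candidates is itself smooth, so it is a legitimate
    \<open>u\<close> in both adjoint identities; subtracting them leaves the integral of its
    square.\<close>
  let ?\<psi> = "adjoint_formula d B \<phi>" and ?u = "\<lambda>x. \<psi> x + (-1) * adjoint_formula d B \<phi> x"
  have t: "test_fun \<psi>" "test_fun ?\<psi>" using a test_fun_adjoint_formula[OF \<phi>] by auto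
  have u: "test_fun ?u" by (intro test_fun_add test_fun_cmult t)
  have "smooth_on Q ?u" using smooth_on_subset[OF test_fun_smooth[OF u]] by simp
  then have "(LINT x|lebesgue_on Q. ?u x * \<psi> x) = (LINT x|lebesgue_on Q. ?u x * ?\<psi> x)"
    using spec[OF conjunct2[OF a], of ?u] adjoint_formula_adjoint[OF \<phi>, of ?u] by simp
  moreover have "(LINT x|lebesgue_on Q. ?u x * g x) = (LINT x|lborel. ?u x * g x)" if "test_fun g" for g
    using borel_measurable_times[OF test_fun_measurable[OF u] test_fun_measurable[OF that]]
      test_fun_outside[OF that] by (intro integral_on_Q_vanishing) auto
  moreover have "integrable lborel (\<lambda>x. ?u x * g x)" if "test_fun g" for g
    using test_fun_mult_continuous(2)[OF u test_fun_continuous[OF that]] .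
  ultimately have 0: "(LINT x|lborel. ?u x * \<psi> x - ?u x * ?\<psi> x) = 0"
    using t by (subst Bochner_Integration.integral_diff) auto
  have "?u x * \<psi> x - ?u x * ?\<psi> x = ?u x * ?u x" for x by (simp only: ring_distribs)
  from 0[unfolded this] have "(LINT x|lborel. ?u x * ?u x) = 0" .
  then have "?u x = 0" for x by (rule test_fun_eq_0[OF u])
  then have "\<psi> x = ?\<psi> x" for x by (metis add.commute add_0 add_diff_cancel mult_minus1 uminus_add_conv_diff eq_iff_diff_eq_0)
  then show "\<psi> = ?\<psi>" by (rule ext)
qed

subsection \<open>Averages of dilations\<close>

lemma iter_deriv_cmult:
  assumes "smooth_on UNIV f"
  shows "iter_deriv J (\<lambda>x. c * f x) = (\<lambda>x. c * iter_deriv J f x)"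
proof (induction J)
  case (Cons i J)
  have d: "iter_deriv J f differentiable (at y)" for y
    using assms unfolding smooth_on_def by blast
  show ?case unfolding iter_deriv.simps Cons.IH
    by (auto simp: partial_deriv_mult[OF _ d] partial_deriv_const)
qed simp

text \<open>The law of the random center \<open>z\<close>. It is never rescaled, unlike an ordinary
  approximate identity: the factor \<open>1 - t\<close> in front of \<open>z\<close> does the
  shrinking. Support in \<open>Q\<close> keeps all centers in the cube.\<close>

definition mollifier :: "(real ^ 'n::finite \<Rightarrow> real) \<Rightarrow> bool" where
  "mollifier \<eta> \<longleftrightarrow> test_fun \<eta> \<and> (\<forall>x. 0 \<le> \<eta> x) \<and> (LINT x|lborel. \<eta> x) = 1"

lemma mollifier_exists: "\<exists>\<eta> :: real ^ 'n::finite \<Rightarrow> real. mollifier \<eta>"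
proof -
  \<comment> \<open>In each coordinate the two factors are positive exactly for values above 1/4 and
    below 3/4, so \<open>b\<close> lives on a box whose closure stays inside
    \<open>Q\<close>.\<close>
  define b :: "real ^ 'n \<Rightarrow> real" where
    "b x = (\<Prod>i\<in>UNIV. flat_exp 1 (- 1/4 + 1 * x $ i) * flat_exp 1 (3/4 + (-1) * x $ i))" for x
  have nonneg: "0 \<le> b x" for x by (auto simp: b_def flat_exp_def intro!: prod_nonneg)
  have pos: "0 < b (\<chi> i. 1/2)" by (auto simp: b_def flat_exp_def intro!: prod_pos)
  have b: "test_fun b" unfolding test_fun_iff
  proof (intro conjI exI allI impI)
    show "smooth_on UNIV b" unfolding b_def[abs_def]
      by (intro smooth_on_prod smooth_on_mult smooth_on_flat_exp open_UNIV)
    show "compact (cbox (\<chi> i. 1/4) (\<chi> i. 3/4) :: (real ^ 'n) set)" by (rule compact_cbox)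
    show "cbox (\<chi> i. 1/4) (\<chi> i. 3/4) \<subseteq> (Q :: (real ^ 'n) set)"
    proof
      fix x :: "real ^ 'n" assume "x \<in> cbox (\<chi> i. 1/4) (\<chi> i. 3/4)"
      then have *: "1/4 \<le> x $ i \<and> x $ i \<le> 3/4" for i by (simp add: mem_box_cart)
      have "0 < x $ i \<and> x $ i < 1" for i using *[of i] by linarith
      then show "x \<in> Q" by (simp add: Q_def)
    qed
    fix x :: "real ^ 'n" assume "x \<notin> cbox (\<chi> i. 1/4) (\<chi> i. 3/4)"
    then obtain i where "x $ i < 1/4 \<or> 3/4 < x $ i" by (auto simp: mem_box_cart not_le)
    then have "flat_exp 1 (- 1/4 + 1 * x $ i) * flat_exp 1 (3/4 + (-1) * x $ i) = 0"
      by (auto simp: flat_exp_def)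
    then show "b x = 0" unfolding b_def by (intro prod_zero) auto
  qed
  have "(LINT x|lborel. b x) \<noteq> 0"
  proof
    assume "(LINT x|lborel. b x) = 0"
    then have "AE x in lborel. b x = 0"
      using integral_nonneg_eq_0_iff_AE[OF test_fun_integrable[OF b]] nonneg by simp
    then have "(LINT x|lborel. b x * b x) = 0"
      by (intro integral_eq_zero_AE) auto
    then have "b (\<chi> i. 1/2) = 0" by (rule test_fun_eq_0[OF b])
    then show False using pos by simp
  qed
  moreover have "0 \<le> (LINT x|lborel. b x)" using nonneg by simp
  ultimately have "mollifier (\<lambda>x. (1 / (LINT x|lborel. b x)) * b x)"
    using test_fun_cmult[OF b, of "1 / (LINT x|lborel. b x)"] nonneg unfolding mollifier_def by simp
  then show ?thesis by blast
qed

section \<open>Taylor estimates and differentiation under the integral sign\<close>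

lemma test_fun_partial_bound:
  fixes f :: "real ^ 'n::finite \<Rightarrow> real"
  assumes "test_fun f"
  obtains M where "\<And>i x. \<bar>partial_deriv i f x\<bar> \<le> M" "0 \<le> M"
proof -
  have "\<exists>M. \<forall>x. \<bar>partial_deriv i f x\<bar> \<le> M" for i
    using test_fun_bounded[OF test_fun_partial_deriv[OF assms]] by metis
  then obtain M where M: "\<And>i x. \<bar>partial_deriv i f x\<bar> \<le> M i" by metis
  have "\<bar>partial_deriv i f x\<bar> \<le> (\<Sum>i\<in>UNIV. \<bar>M i\<bar>)" for i x
  proof -
    have "\<bar>partial_deriv i f x\<bar> \<le> \<bar>M i\<bar>" using M[of i x] by simp
    also have "\<dots> \<le> (\<Sum>i\<in>UNIV. \<bar>M i\<bar>)" by (rule member_le_sum) auto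
    finally show ?thesis .
  qed
  then show thesis by (rule that) (simp add: sum_nonneg)
qed

lemma onorm_sum_components_le:
  fixes c :: "'n::finite \<Rightarrow> real"
  assumes "\<And>i. \<bar>c i\<bar> \<le> M"
  shows "onorm (\<lambda>h::real^'n. \<Sum>i\<in>UNIV. h $ i * c i) \<le> real CARD('n) * M"
proof (rule onorm_le)
  fix h :: "real ^ 'n"
  have "norm (\<Sum>i\<in>UNIV. h $ i * c i) \<le> (\<Sum>i\<in>(UNIV::'n set). norm h * M)"
  proof (rule order_trans[OF norm_sum sum_mono])
    show "norm (h $ i * c i) \<le> norm h * M" for i
      using mult_mono[OF component_le_norm_cart[of h i] assms[of i]] by (simp add: abs_mult)
  qed
  then show "norm (\<Sum>i\<in>UNIV. h $ i * c i) \<le> real CARD('n) * M * norm h" by (simp add: mult_ac)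
qed

lemma test_fun_lipschitz:
  fixes f :: "real ^ 'n::finite \<Rightarrow> real"
  assumes f: "test_fun f"
  obtains L where "\<And>x y. \<bar>f x - f y\<bar> \<le> L * norm (x - y)" "0 \<le> L"
proof -
  obtain M where M: "\<And>i x. \<bar>partial_deriv i f x\<bar> \<le> M" "0 \<le> M"
    using test_fun_partial_bound[OF f] by metis
  have "norm (f x - f y) \<le> (real CARD('n) * M) * norm (x - y)" for x y
    by (rule differentiable_bound[OF convex_UNIV])
       (auto intro!: has_derivative_partial_deriv test_fun_differentiable f onorm_sum_components_le M)
  then show thesis using M(2) by (intro that[of "real CARD('n) * M"]) auto
qed

text \<open>The partial derivatives are test functions and hence globally Lipschitz. What matters is
  that \<open>C\<close> does not depend on \<open>x\<close>: the remainder can then be integrated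
  against any integrable weight.\<close>

lemma test_fun_taylor:
  fixes f :: "real ^ 'n::finite \<Rightarrow> real"
  assumes f: "test_fun f"
  obtains C where "\<And>x h. \<bar>f (x + h) - f x - (\<Sum>i\<in>UNIV. h $ i * partial_deriv i f x)\<bar> \<le> C * (norm h)\<^sup>2"
    "0 \<le> C"
proof -
  have "\<exists>L\<ge>0. \<forall>x y. \<bar>partial_deriv i f x - partial_deriv i f y\<bar> \<le> L * norm (x - y)" for i
    using test_fun_lipschitz[OF test_fun_partial_deriv[OF f]] by metis
  then obtain L where L: "\<And>i x y. \<bar>partial_deriv i f x - partial_deriv i f y\<bar> \<le> L i * norm (x - y)"
    "\<And>i. 0 \<le> L i" by metis
  define C where "C = (\<Sum>i\<in>UNIV. L i)"
  have C: "\<bar>partial_deriv i f x - partial_deriv i f y\<bar> \<le> C * norm (x - y)" for i x y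
  proof -
    have "L i \<le> C" unfolding C_def by (rule member_le_sum) (auto simp: L)
    then show ?thesis using L(1)[of i x y] mult_right_mono[of "L i" C "norm (x - y)"] by simp
  qed
  have "norm (f (x + h) - f x - (\<Sum>i\<in>UNIV. (x + h - x) $ i * partial_deriv i f x))
      \<le> norm (x + h - x) * (real CARD('n) * (C * norm h))" for x h
  proof (rule differentiable_bound_linearization[where S = "cball x (norm h)"
        and f' = "\<lambda>y h. \<Sum>i\<in>UNIV. h $ i * partial_deriv i f y"])
    show "x + t *\<^sub>R (x + h - x) \<in> cball x (norm h)" if "t \<in> {0..1}" for t
      using that by (simp add: mult_left_le_one_le dist_norm)
    show "(f has_derivative (\<lambda>h. \<Sum>i\<in>UNIV. h $ i * partial_deriv i f y)) (at y within cball x (norm h))" for y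
      by (rule has_derivative_at_withinI[OF has_derivative_partial_deriv[OF test_fun_differentiable[OF f]]])
    show "onorm ((\<lambda>h. \<Sum>i\<in>UNIV. h $ i * partial_deriv i f y) - (\<lambda>h. \<Sum>i\<in>UNIV. h $ i * partial_deriv i f x))
        \<le> real CARD('n) * (C * norm h)" if "y \<in> cball x (norm h)" for y
    proof -
      have "(\<lambda>h. \<Sum>i\<in>UNIV. h $ i * partial_deriv i f y) - (\<lambda>h. \<Sum>i\<in>UNIV. h $ i * partial_deriv i f x)
          = (\<lambda>h. \<Sum>i\<in>UNIV. h $ i * (partial_deriv i f y - partial_deriv i f x))"
        by (auto simp: fun_eq_iff sum_subtractf right_diff_distrib)
      moreover have "C * norm (y - x) \<le> C * norm h"
        using that L(2) by (intro mult_left_mono) (auto simp: C_def dist_norm norm_minus_commute sum_nonneg)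
      ultimately show ?thesis using C by (auto intro!: onorm_sum_components_le intro: order_trans)
    qed
  qed simp
  then show thesis
    by (intro that[of "real CARD('n) * C"]) (auto simp: power2_eq_square mult_ac C_def L sum_nonneg)
qed

lemma integrable_bounded_mult:
  fixes f g :: "real ^ 'n::finite \<Rightarrow> real"
  assumes g: "g \<in> borel_measurable borel" "\<And>x. \<bar>g x\<bar> \<le> M" and f: "integrable lborel f"
  shows "integrable lborel (\<lambda>x. g x * f x)"
proof (rule Bochner_Integration.integrable_bound)
  show "integrable lborel (\<lambda>x. M * f x)" using f by simp
  show "(\<lambda>x. g x * f x) \<in> borel_measurable lborel" using g(1) f by simp
  have "\<bar>g x\<bar> \<le> \<bar>M\<bar>" for x using g(2)[of x] by linarith
  then show "AE x in lborel. norm (g x * f x) \<le> norm (M * f x)"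
    by (simp add: abs_mult mult_right_mono)
qed

text \<open>Integrating the uniform Taylor remainder against the absolute value of \<open>w\<close>
  leaves an error of order \<open>(norm h)\<^sup>2\<close>. The kernel argument is affine in both
  variables because that is the form produced by solving for the center of a dilation.\<close>

lemma has_derivative_convolution:
  fixes w \<rho> :: "real ^ 'n::finite \<Rightarrow> real"
  assumes \<rho>: "test_fun \<rho>" and w: "integrable lborel w"
  shows "((\<lambda>x. LINT y|lborel. \<rho> (a *\<^sub>R y + b *\<^sub>R x) * w y) has_derivative
    (\<lambda>h. \<Sum>i\<in>UNIV. h $ i * (b * (LINT y|lborel. partial_deriv i \<rho> (a *\<^sub>R y + b *\<^sub>R x) * w y)))) (at x)"
proof -
  obtain C where C: "\<And>x h. \<bar>\<rho> (x + h) - \<rho> x - (\<Sum>i\<in>UNIV. h $ i * partial_deriv i \<rho> x)\<bar> \<le> C * (norm h)\<^sup>2"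
    "0 \<le> C" using test_fun_taylor[OF \<rho>] by metis
  have int: "integrable lborel (\<lambda>y. g (a *\<^sub>R y + c) * w y)" if g: "test_fun g" for g c
  proof -
    obtain M where "\<And>x. \<bar>g x\<bar> \<le> M" using test_fun_bounded[OF g] by metis
    then show ?thesis
      by (intro integrable_bounded_mult w measurable_compose[OF _ test_fun_measurable[OF g]]) auto
  qed
  let ?G = "\<lambda>x. LINT y|lborel. \<rho> (a *\<^sub>R y + b *\<^sub>R x) * w y"
  let ?D = "\<lambda>h. \<Sum>i\<in>UNIV. h $ i * (b * (LINT y|lborel. partial_deriv i \<rho> (a *\<^sub>R y + b *\<^sub>R x) * w y))"
  let ?I = "LINT y|lborel. \<bar>w y\<bar>"
  have est: "norm (?G (x + h) - ?G x - ?D h) \<le> C * b\<^sup>2 * ?I * (norm h)\<^sup>2" for h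
  proof -
    \<comment> \<open>The Taylor remainder of \<open>\<rho>\<close> at \<open>p\<close> for the
      increment \<open>b *\<^sub>R h\<close>, which is how far the kernel argument moves when
      \<open>x\<close> moves by \<open>h\<close>.\<close>
    let ?r = "\<lambda>p. \<rho> (p + b *\<^sub>R h) - \<rho> p - (\<Sum>i\<in>UNIV. (b *\<^sub>R h) $ i * partial_deriv i \<rho> p)"
    let ?R = "\<lambda>y. ?r (a *\<^sub>R y + b *\<^sub>R x) * w y"
    have e: "?R y = \<rho> (a *\<^sub>R y + (b *\<^sub>R x + b *\<^sub>R h)) * w y - \<rho> (a *\<^sub>R y + b *\<^sub>R x) * w y
        - (\<Sum>i\<in>UNIV. (h $ i * b) * (partial_deriv i \<rho> (a *\<^sub>R y + b *\<^sub>R x) * w y))" for y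
      by (simp add: right_diff_distrib left_diff_distrib sum_distrib_right sum_distrib_left mult_ac add.assoc)
    note ints = int[OF \<rho>] int[OF test_fun_partial_deriv[OF \<rho>]]
    have iR: "integrable lborel ?R" unfolding e
      by (intro Bochner_Integration.integrable_diff Bochner_Integration.integrable_sum
          integrable_mult_right ints)
    have "?G (x + h) - ?G x - ?D h = (LINT y|lborel. ?R y)" unfolding e
      by (simp add: ints scaleR_right_distrib mult.assoc)
    also have "norm \<dots> \<le> (LINT y|lborel. C * (norm (b *\<^sub>R h))\<^sup>2 * \<bar>w y\<bar>)"
    proof (rule order_trans[OF integral_norm_bound integral_mono])
      show "norm (?R y) \<le> C * (norm (b *\<^sub>R h))\<^sup>2 * \<bar>w y\<bar>" for y
        using C(1) by (simp only: real_norm_def abs_mult mult_right_mono abs_ge_zero)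
    qed (use iR w in auto)
    also have "\<dots> = C * b\<^sup>2 * ?I * (norm h)\<^sup>2" by (simp add: power_mult_distrib mult_ac)
    finally show ?thesis .
  qed
  show ?thesis unfolding has_derivative_at
  proof (intro conjI)
    show "bounded_linear ?D"
      by (intro bounded_linear_sum bounded_linear_mult_const bounded_linear_vec_nth)
    have lim: "((\<lambda>h::real^'n. C * b\<^sup>2 * ?I * norm h) \<longlongrightarrow> 0) (at 0)"
      by (auto intro!: tendsto_eq_intros)
    have "norm (norm (?G (x + h) - ?G x - ?D h) / norm h) \<le> C * b\<^sup>2 * ?I * norm h" if "h \<noteq> 0" for h
      using est[of h] that by (simp add: divide_le_eq power2_eq_square mult.assoc)
    then have "\<forall>\<^sub>F h in at 0. norm (norm (?G (x + h) - ?G x - ?D h) / norm h) \<le> C * b\<^sup>2 * ?I * norm h"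
      by (auto simp: eventually_at_filter)
    then show "(\<lambda>h. norm (?G (x + h) - ?G x - ?D h) / norm h) \<midarrow>0\<rightarrow> 0"
      using lim by (rule Lim_null_comparison)
  qed
qed

lemma smooth_on_convolution:
  fixes w :: "real ^ 'n::finite \<Rightarrow> real"
  assumes \<rho>: "test_fun \<rho>" and w: "integrable lborel w"
  shows "smooth_on UNIV (\<lambda>x. LINT y|lborel. \<rho> (a *\<^sub>R y + b *\<^sub>R x) * w y)"
proof (rule smooth_on_coinduct[OF open_UNIV])
  \<comment> \<open>Each differentiation replaces the kernel by one of its partial derivatives and
    brings out a factor \<open>b\<close>, collected in \<open>c\<close>.\<close>
  let ?F = "{\<lambda>x. c * (LINT y|lborel. \<rho> (a *\<^sub>R y + b *\<^sub>R x) * w y) | c \<rho>. test_fun \<rho>}"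
  show "(\<lambda>x. LINT y|lborel. \<rho> (a *\<^sub>R y + b *\<^sub>R x) * w y) \<in> ?F"
    using \<rho> by (intro CollectI exI[of _ 1] exI[of _ \<rho>]) auto
  show "h differentiable (at x)" if "h \<in> ?F" for h x
    using that has_derivative_mult_right[OF has_derivative_convolution[OF _ w]]
    unfolding differentiable_def by blast
  show "\<exists>g\<in>?F. \<forall>x\<in>UNIV. partial_deriv i h x = g x" if "h \<in> ?F" for h i
  proof -
    obtain c \<rho> where \<rho>: "test_fun \<rho>"
      and h: "h = (\<lambda>x. c * (LINT y|lborel. \<rho> (a *\<^sub>R y + b *\<^sub>R x) * w y))" using \<open>h \<in> ?F\<close> by blast
    have "partial_deriv i h x = (c * b) * (LINT y|lborel. partial_deriv i \<rho> (a *\<^sub>R y + b *\<^sub>R x) * w y)" for x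
      unfolding h partial_deriv_eq[OF has_derivative_mult_right[OF has_derivative_convolution[OF \<rho> w]]]
      by (simp add: axis_def if_distrib[of "\<lambda>x. x * _"] cong: if_cong)
    then show ?thesis using test_fun_partial_deriv[OF \<rho>] by blast
  qed
qed

definition dil_avg :: "(real ^ 'n::finite \<Rightarrow> real) \<Rightarrow> (real ^ 'n \<Rightarrow> real) \<Rightarrow> real \<Rightarrow> real ^ 'n \<Rightarrow> real" where
  "dil_avg \<eta> w t x = (LINT z|lborel. \<eta> z * w (t *\<^sub>R x + (1 - t) *\<^sub>R z))"

lemma smooth_on_dil_avg:
  fixes w :: "real ^ 'n::finite \<Rightarrow> real"
  assumes \<eta>: "test_fun \<eta>" and w: "integrable lborel w" and t: "t \<noteq> 1"
  shows "smooth_on UNIV (dil_avg \<eta> w t)"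
proof -
  \<comment> \<open>Solving y = t x + (1 - t) z for z gives the coefficients of \<open>y\<close> and
    \<open>x\<close> in the kernel; the prefactor is the Jacobian. Now \<open>x\<close> occurs only
    in the smooth kernel and no longer in \<open>w\<close>.\<close>
  have "dil_avg \<eta> w t = (\<lambda>x. (1 / \<bar>1 - t\<bar> ^ CARD('n)) *
      (LINT y|lborel. \<eta> ((1 / (1 - t)) *\<^sub>R y + (- t / (1 - t)) *\<^sub>R x) * w y))"
  proof
    fix x
    let ?f = "\<lambda>y. \<eta> ((1 / (1 - t)) *\<^sub>R y + (- t / (1 - t)) *\<^sub>R x) * w y"
    have m: "?f \<in> borel_measurable borel"
      by (intro borel_measurable_times measurable_compose[OF _ test_fun_measurable[OF \<eta>]]) (use w in auto)
    have "?f (t *\<^sub>R x + (1 - t) *\<^sub>R z) = \<eta> z * w (t *\<^sub>R x + (1 - t) *\<^sub>R z)" for z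
      using t by (simp add: scaleR_right_distrib)
    then have "dil_avg \<eta> w t x = (LINT z|lborel. ?f (t *\<^sub>R x + (1 - t) *\<^sub>R z))"
      by (simp only: dil_avg_def)
    also have "\<dots> = (1 / \<bar>1 - t\<bar> ^ CARD('n)) * (LINT y|lborel. ?f y)"
      by (subst lborel_integral_affine[OF m]) (use t in simp_all)
    finally show "dil_avg \<eta> w t x = (1 / \<bar>1 - t\<bar> ^ CARD('n)) * (LINT y|lborel. ?f y)" .
  qed
  then show ?thesis by (simp only: smooth_on_cmult[OF open_UNIV smooth_on_convolution[OF \<eta> w]])
qed

section \<open>The variation of an average of dilations\<close>

definition admissible :: "nat \<Rightarrow> ('n::finite list \<Rightarrow> real ^ 'n \<Rightarrow> real) \<Rightarrow> bool" where
  "admissible d \<phi> \<longleftrightarrow> test_field d \<phi> \<and> (\<forall>x\<in>Q. sqrt (\<Sum>I\<in>coords d. (\<phi> I x)\<^sup>2) \<le> 1)"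

lemma PV_alt:
  "PV d B u = (SUP \<phi>\<in>{\<phi>. admissible d \<phi>}. ereal (LINT x|lebesgue_on Q. u x * adjoint_formula d B \<phi> x))"
  unfolding PV_def admissible_def[symmetric]
  by (intro SUP_cong) (auto simp: admissible_def formal_adjoint_eq)

text \<open>Composing with the inverse dilation moves the support by the forward one. The image of a
  compact subset of \<open>Q\<close> is compact and, by convexity, still in
  \<open>Q\<close>.\<close>

lemma test_fun_dilation:
  assumes f: "test_fun f" and z: "z \<in> Q" and t: "0 < t" "t \<le> 1"
  shows "test_fun (\<lambda>y. c * f ((1 / t) *\<^sub>R y + (- (1 - t) / t) *\<^sub>R z))"
  unfolding test_fun_iff
proof (intro conjI)
  show "smooth_on UNIV (\<lambda>y. c * f ((1 / t) *\<^sub>R y + (- (1 - t) / t) *\<^sub>R z))"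
    by (intro smooth_on_cmult smooth_on_affine test_fun_smooth f open_UNIV)
  obtain K where K: "compact K" "K \<subseteq> Q" "\<And>x. x \<notin> K \<Longrightarrow> f x = 0"
    using test_fun_support[OF f] by metis
  let ?K = "(\<lambda>x. t *\<^sub>R x + (1 - t) *\<^sub>R z) ` K"
  have "f ((1 / t) *\<^sub>R y + (- (1 - t) / t) *\<^sub>R z) = 0" if "y \<notin> ?K" for y
  proof (rule K(3), rule notI)
    assume "(1 / t) *\<^sub>R y + (- (1 - t) / t) *\<^sub>R z \<in> K"
    moreover have "y = t *\<^sub>R ((1 / t) *\<^sub>R y + (- (1 - t) / t) *\<^sub>R z) + (1 - t) *\<^sub>R z"
      using t by (simp add: scaleR_right_distrib flip: scaleR_left_distrib)
    ultimately show False using that by blast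
  qed
  moreover have "compact ?K" by (intro compact_continuous_image continuous_intros K)
  moreover have "?K \<subseteq> Q" using K(2) z t by (auto intro!: mem_Q_dilation)
  ultimately show "\<exists>K. compact K \<and> K \<subseteq> Q \<and>
      (\<forall>x. x \<notin> K \<longrightarrow> c * f ((1 / t) *\<^sub>R x + (- (1 - t) / t) *\<^sub>R z) = 0)" by auto
qed

text \<open>The factors \<open>t ^ length I \<le> 1\<close> compensate the homogeneity of each order separately, so
  that the adjoint commutes with the dilation although the operator mixes orders.\<close>

definition dilated_field ::
    "real \<Rightarrow> real ^ 'n::finite \<Rightarrow> ('n list \<Rightarrow> real ^ 'n \<Rightarrow> real) \<Rightarrow> 'n list \<Rightarrow> real ^ 'n \<Rightarrow> real" where
  "dilated_field t z \<phi> I y = t ^ length I * \<phi> I ((1 / t) *\<^sub>R y + (- (1 - t) / t) *\<^sub>R z)"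

lemma adjoint_formula_dilated_field:
  assumes \<phi>: "test_field d \<phi>" and t: "0 < t"
  shows "adjoint_formula d B (dilated_field t z \<phi>) y =
    adjoint_formula d B \<phi> ((1 / t) *\<^sub>R y + (- (1 - t) / t) *\<^sub>R z)"
  unfolding adjoint_formula_def
proof (intro sum.cong refl arg_cong2[where f = "(*)"])
  fix I J :: "'a list" assume "I \<in> coords d" and J: "J \<in> words (length I)"
  then have s: "smooth_on UNIV (\<phi> I)" using \<phi> test_fun_smooth by (auto simp: test_field_def)
  \<comment> \<open>Squareness of the blocks: the word of derivatives has the length of the output
    index \<open>I\<close>, so the two powers of \<open>t\<close> cancel.\<close>
  have "t ^ length I * (1 / t) ^ length (rev J) = 1"
    using t J by (simp add: words_def power_divide)
  then show "iter_deriv (rev J) (dilated_field t z \<phi> I) y =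
      iter_deriv (rev J) (\<phi> I) ((1 / t) *\<^sub>R y + (- (1 - t) / t) *\<^sub>R z)"
    unfolding dilated_field_def[abs_def] iter_deriv_cmult[OF smooth_on_affine[OF s]] iter_deriv_affine[OF s]
    by (metis mult.assoc mult_1)
qed

lemma admissible_dilated_field:
  assumes \<phi>: "admissible d \<phi>" and z: "z \<in> Q" and t: "0 < t" "t \<le> 1"
  shows "admissible d (dilated_field t z \<phi>)"
  unfolding admissible_def
proof (intro conjI ballI)
  have tf: "test_fun (\<phi> I)" if "I \<in> coords d" for I
    using \<phi> that by (simp add: admissible_def test_field_def)
  then show "test_field d (dilated_field t z \<phi>)" unfolding test_field_def dilated_field_def[abs_def]
    using test_fun_dilation z t by blast
  fix y
  let ?p = "(1 / t) *\<^sub>R y + (- (1 - t) / t) *\<^sub>R z"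
  have "(\<Sum>I\<in>coords d. (dilated_field t z \<phi> I y)\<^sup>2) \<le> (\<Sum>I\<in>coords d. (\<phi> I ?p)\<^sup>2)"
  proof (rule sum_mono)
    fix I :: "'a list"
    have "(t ^ length I)\<^sup>2 \<le> 1" using t by (simp add: power_le_one)
    then show "(dilated_field t z \<phi> I y)\<^sup>2 \<le> (\<phi> I ?p)\<^sup>2"
      unfolding dilated_field_def power_mult_distrib by (intro mult_left_le_one_le) auto
  qed
  also have "\<dots> \<le> 1"
  \<comment> \<open>Admissibility bounds the norm of the field on \<open>Q\<close> only, while the
    inverse dilation may lead out of \<open>Q\<close>; there all coordinates vanish.\<close>
  proof (cases "?p \<in> Q")
    case True
    then show ?thesis using \<phi> by (simp add: admissible_def)
  next
    case False
    then have "(\<Sum>I\<in>coords d. (\<phi> I ?p)\<^sup>2) = 0" using tf test_fun_outside by (intro sum.neutral) auto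
    then show ?thesis by simp
  qed
  finally show "sqrt (\<Sum>I\<in>coords d. (dilated_field t z \<phi> I y)\<^sup>2) \<le> 1" by simp
qed

text \<open>Fubini, arranged so that the center is frozen in the inner integral and a single
  dilation can be treated. For joint integrability, bound \<open>\<psi>\<close> by a constant and
  substitute in \<open>x\<close>: the inner integral of the absolute value of \<open>w\<close>
  becomes a multiple of its norm in \<open>L\<^sup>1\<close> that does not depend on
  \<open>z\<close>, and \<open>\<eta>\<close> is integrable.\<close>

lemma integral_dil_avg_mult:
  fixes w :: "real ^ 'n::finite \<Rightarrow> real"
  assumes \<eta>: "mollifier \<eta>" and w: "integrable lborel w" and \<psi>: "test_fun \<psi>" and t: "0 < t"
  shows "integrable lborel (\<lambda>z. \<eta> z * (LINT x|lborel. w (t *\<^sub>R x + (1 - t) *\<^sub>R z) * \<psi> x))"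
    and "(LINT x|lborel. dil_avg \<eta> w t x * \<psi> x) =
      (LINT z|lborel. \<eta> z * (LINT x|lborel. w (t *\<^sub>R x + (1 - t) *\<^sub>R z) * \<psi> x))"
proof -
  have [measurable]: "w \<in> borel_measurable borel" "\<psi> \<in> borel_measurable borel" "\<eta> \<in> borel_measurable borel"
    using w test_fun_measurable \<psi> \<eta> by (auto simp: mollifier_def)
  have \<eta>0: "0 \<le> \<eta> z" and \<eta>i: "integrable lborel \<eta>" for z
    using \<eta> test_fun_integrable by (auto simp: mollifier_def)
  obtain M where M: "\<And>x. \<bar>\<psi> x\<bar> \<le> M" "0 \<le> M" using test_fun_bounded[OF \<psi>] by metis
  define F where "F z x = \<eta> z * (w (t *\<^sub>R x + (1 - t) *\<^sub>R z) * \<psi> x)" for z x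
  have F_meas: "case_prod F \<in> borel_measurable (lborel \<Otimes>\<^sub>M lborel)"
    unfolding F_def[abs_def] by measurable
  have int: "integrable (lborel \<Otimes>\<^sub>M lborel) (case_prod F)"
  proof (rule integrableI_bounded[OF F_meas])
    let ?W = "\<integral>\<^sup>+x. ennreal \<bar>w x\<bar> \<partial>lborel"
    have "(\<integral>\<^sup>+p. ennreal (norm (case_prod F p)) \<partial>(lborel \<Otimes>\<^sub>M lborel)) =
        (\<integral>\<^sup>+z. \<integral>\<^sup>+x. ennreal (norm (F z x)) \<partial>lborel \<partial>lborel)"
      using F_meas by (subst lborel.nn_integral_fst[symmetric]) auto
    also have "\<dots> \<le> (\<integral>\<^sup>+z. \<integral>\<^sup>+x. ennreal (\<eta> z) * (ennreal M * ennreal \<bar>w ((1 - t) *\<^sub>R z + t *\<^sub>R x)\<bar>) \<partial>lborel \<partial>lborel)"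
    proof (intro nn_integral_mono)
      fix z x
      have "norm (F z x) \<le> \<eta> z * (M * \<bar>w ((1 - t) *\<^sub>R z + t *\<^sub>R x)\<bar>)"
        using \<eta>0[of z] M(1)[of x]
        by (auto simp: F_def abs_mult add.commute mult.commute[of _ "\<bar>\<psi> x\<bar>"] intro!: mult_left_mono mult_right_mono)
      then show "ennreal (norm (F z x)) \<le> ennreal (\<eta> z) * (ennreal M * ennreal \<bar>w ((1 - t) *\<^sub>R z + t *\<^sub>R x)\<bar>)"
        using M(2) \<eta>0 by (simp flip: ennreal_mult)
    qed
    also have "\<dots> = (\<integral>\<^sup>+z. ennreal (\<eta> z) * (ennreal M * (ennreal (1 / \<bar>t\<bar> ^ CARD('n)) * ?W)) \<partial>lborel)"
      using t by (simp add: nn_integral_cmult nn_integral_lborel_affine[where f = "\<lambda>x. ennreal \<bar>w x\<bar>"])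
    also have "\<dots> = (\<integral>\<^sup>+z. ennreal (\<eta> z) \<partial>lborel) * (ennreal M * (ennreal (1 / \<bar>t\<bar> ^ CARD('n)) * ?W))"
      by (simp add: nn_integral_multc)
    also have "\<dots> < \<infinity>"
      using w \<eta>i \<eta>0 by (auto simp: ennreal_mult_less_top integrable_iff_bounded)
    finally show "(\<integral>\<^sup>+p. ennreal (norm (case_prod F p)) \<partial>(lborel \<Otimes>\<^sub>M lborel)) < \<infinity>" .
  qed
  have "integrable lborel (\<lambda>z. LINT x|lborel. F z x)"
    using lborel_pair.integrable_fst[OF int] by simp
  then show "integrable lborel (\<lambda>z. \<eta> z * (LINT x|lborel. w (t *\<^sub>R x + (1 - t) *\<^sub>R z) * \<psi> x))"
    by (simp add: F_def)
  have "dil_avg \<eta> w t x * \<psi> x = (LINT z|lborel. F z x)" for x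
  proof -
    have "(LINT z|lborel. F z x) = (LINT z|lborel. (\<eta> z * w (t *\<^sub>R x + (1 - t) *\<^sub>R z)) * \<psi> x)"
      by (simp add: F_def mult.assoc)
    then show ?thesis by (simp only: integral_mult_left_zero dil_avg_def)
  qed
  then have "(LINT x|lborel. dil_avg \<eta> w t x * \<psi> x) = (LINT x|lborel. LINT z|lborel. F z x)" by simp
  also have "\<dots> = (LINT z|lborel. LINT x|lborel. F z x)"
    using lborel_pair.Fubini_integral[OF int] .
  finally show "(LINT x|lborel. dil_avg \<eta> w t x * \<psi> x) =
      (LINT z|lborel. \<eta> z * (LINT x|lborel. w (t *\<^sub>R x + (1 - t) *\<^sub>R z) * \<psi> x))"
    by (simp add: F_def)
qed

text \<open>The bound holds for each center in \<open>Q\<close> separately and survives averaging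
  because \<open>\<eta>\<close> is nonnegative with total mass 1.\<close>

lemma PV_dil_avg_le:
  fixes w :: "real ^ 'n::finite \<Rightarrow> real"
  assumes \<eta>: "mollifier \<eta>" and w: "integrable lborel w" 
    and t: "0 < t" "t < 1" and P: "PV d B w \<le> ereal P"
  shows "PV d B (dil_avg \<eta> w t) \<le> ereal (P / t ^ CARD('n))"
  unfolding PV_alt
proof (rule SUP_least)
  fix \<phi> assume "\<phi> \<in> {\<phi>. admissible d (\<phi> :: 'n list \<Rightarrow> real ^ 'n \<Rightarrow> real)}"
  then have \<phi>: "admissible d \<phi>" and tf: "test_field d \<phi>" by (auto simp: admissible_def)
  let ?\<psi> = "adjoint_formula d B \<phi>"
  have \<psi>: "test_fun ?\<psi>" by (rule test_fun_adjoint_formula[OF tf])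
  have \<eta>': "test_fun \<eta>" "\<And>z. 0 \<le> \<eta> z" "(LINT z|lborel. \<eta> z) = 1" using \<eta> by (auto simp: mollifier_def)
  have wm [measurable]: "w \<in> borel_measurable borel" using w by auto
  have vm: "dil_avg \<eta> w t \<in> borel_measurable borel"
    by (intro borel_measurable_continuous_onI smooth_on_continuous smooth_on_dil_avg \<eta>' w) (use t in simp)
  \<comment> \<open>The substitution y = t x + (1 - t) z turns this into the pairing of
    \<open>w\<close> with the adjoint of an admissible field; dividing by the power of
    \<open>t\<close> is its Jacobian.\<close>
  have inner: "(LINT x|lborel. w (t *\<^sub>R x + (1 - t) *\<^sub>R z) * ?\<psi> x) \<le> P / t ^ CARD('n)" if z: "z \<in> Q" for z
  proof -
    let ?f = "\<lambda>y. w y * ?\<psi> ((1 / t) *\<^sub>R y + (- (1 - t) / t) *\<^sub>R z)"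
    have ad: "admissible d (dilated_field t z \<phi>)"
      using admissible_dilated_field[OF \<phi> z] t by simp
    then have tf': "test_fun (adjoint_formula d B (dilated_field t z \<phi>))"
      using test_fun_adjoint_formula by (auto simp: admissible_def)
    have f_eq: "?f = (\<lambda>y. w y * adjoint_formula d B (dilated_field t z \<phi>) y)"
      using adjoint_formula_dilated_field[OF tf t(1)] by auto
    have fm: "?f \<in> borel_measurable borel" unfolding f_eq using test_fun_measurable[OF tf'] by simp
    have le: "ereal (LINT y|lebesgue_on Q. ?f y) \<le> PV d B w"
      unfolding PV_alt f_eq by (rule SUP_upper) (simp add: ad)
    have "?f ((1 - t) *\<^sub>R z + t *\<^sub>R x) = w (t *\<^sub>R x + (1 - t) *\<^sub>R z) * ?\<psi> x" for x
    proof -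
      have "(1 / t) *\<^sub>R ((1 - t) *\<^sub>R z + t *\<^sub>R x) + (- (1 - t) / t) *\<^sub>R z = x"
        using t by (simp add: vec_eq_iff field_simps)
      then show ?thesis by (simp only: add.commute[of "(1 - t) *\<^sub>R z"])
    qed
    then have "(LINT x|lborel. w (t *\<^sub>R x + (1 - t) *\<^sub>R z) * ?\<psi> x) =
        (LINT x|lborel. ?f ((1 - t) *\<^sub>R z + t *\<^sub>R x))" by (simp only:)
    also have "\<dots> = (LINT y|lborel. ?f y) / t ^ CARD('n)"
      by (subst lborel_integral_affine[OF fm]) (use t in simp_all)
    also have "(LINT y|lborel. ?f y) = (LINT y|lebesgue_on Q. ?f y)"
    proof (rule integral_on_Q_vanishing[symmetric, OF fm])
      show "?f y = 0" if "y \<notin> Q" for y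
        unfolding fun_cong[OF f_eq] using test_fun_outside[OF tf' that] by simp
    qed
    also have "(LINT y|lebesgue_on Q. ?f y) / t ^ CARD('n) \<le> P / t ^ CARD('n)"
      using order_trans[OF le P] t by (intro divide_right_mono) auto
    finally show ?thesis .
  qed
  have "(LINT x|lebesgue_on Q. dil_avg \<eta> w t x * ?\<psi> x) = (LINT x|lborel. dil_avg \<eta> w t x * ?\<psi> x)"
    using vm test_fun_measurable[OF \<psi>] by (intro integral_on_Q_vanishing) (auto simp: test_fun_outside[OF \<psi>])
  also have "\<dots> = (LINT z|lborel. \<eta> z * (LINT x|lborel. w (t *\<^sub>R x + (1 - t) *\<^sub>R z) * ?\<psi> x))"
    by (rule integral_dil_avg_mult(2)[OF \<eta> w \<psi> t(1)])
  also have "\<dots> \<le> (LINT z|lborel. \<eta> z * (P / t ^ CARD('n)))"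
  proof (rule integral_mono)
    show "integrable lborel (\<lambda>z. \<eta> z * (LINT x|lborel. w (t *\<^sub>R x + (1 - t) *\<^sub>R z) * ?\<psi> x))"
      by (rule integral_dil_avg_mult(1)[OF \<eta> w \<psi> t(1)])
    show "integrable lborel (\<lambda>z. \<eta> z * (P / t ^ CARD('n)))" 
      by (intro integrable_mult_left test_fun_integrable \<eta>')
    \<comment> \<open>Centers outside \<open>Q\<close>, not covered by \<open>inner\<close>, have
      weight 0.\<close>
    show "\<eta> z * (LINT x|lborel. w (t *\<^sub>R x + (1 - t) *\<^sub>R z) * ?\<psi> x) \<le> \<eta> z * (P / t ^ CARD('n))" for z
      using inner[of z] test_fun_outside[OF \<eta>'(1), of z] \<eta>'(2)[of z]
      by (cases "z \<in> Q") (auto intro: mult_left_mono simp del: times_divide_eq_right)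
  qed
  also have "\<dots> = P / t ^ CARD('n)"
    by (simp only: integral_mult_left_zero \<eta>'(3) mult_1)
  finally show "ereal (LINT x|lebesgue_on Q. dil_avg \<eta> w t x * ?\<psi> x) \<le> ereal (P / t ^ CARD('n))" by simp
qed

subsection \<open>Convergence in \<open>L\<^sup>p\<close>\<close>

text \<open>The sum is at most three times its largest term. This takes the place of Minkowski's
  inequality for integrals of p-th powers; the constant is harmless, as it will multiply quantities
  that can be made arbitrarily small.\<close>

lemma abs_powr_sum3_le:
  fixes a b c p :: real
  assumes "0 \<le> p"
  shows "\<bar>a + b + c\<bar> powr p \<le> 3 powr p * (\<bar>a\<bar> powr p + \<bar>b\<bar> powr p + \<bar>c\<bar> powr p)"
proof -
  define m where "m = max \<bar>a\<bar> (max \<bar>b\<bar> \<bar>c\<bar>)"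
  have "\<bar>a + b + c\<bar> \<le> 3 * m" by (auto simp: m_def)
  then have "\<bar>a + b + c\<bar> powr p \<le> (3 * m) powr p" using assms by (intro powr_mono2) auto
  also have "\<dots> = 3 powr p * m powr p" by (rule powr_mult)
  also have "m powr p \<le> \<bar>a\<bar> powr p + \<bar>b\<bar> powr p + \<bar>c\<bar> powr p"
    by (auto simp: m_def max_def)
  finally show ?thesis by simp
qed

lemma convex_on_abs_powr:
  fixes p :: real assumes p: "1 \<le> p"
  shows "convex_on UNIV (\<lambda>x. \<bar>x\<bar> powr p)"
proof (rule convex_onI)
  fix t x y :: real assume t: "0 < t" "t < 1"
  have shrink: "(s * \<bar>z\<bar>) powr p \<le> s * \<bar>z\<bar> powr p" if "0 < s" "s < 1" for s z :: real
  proof -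
    have "s powr p \<le> s powr 1" using that p by (intro powr_mono') auto
    then show ?thesis using that by (simp add: powr_mult mult_right_mono)
  qed
  have "\<bar>(1 - t) *\<^sub>R x + t *\<^sub>R y\<bar> \<le> (1 - t) * \<bar>x\<bar> + t * \<bar>y\<bar>"
    using abs_triangle_ineq[of "(1 - t) * x" "t * y"] t by (simp add: abs_mult)
  then have "\<bar>(1 - t) *\<^sub>R x + t *\<^sub>R y\<bar> powr p \<le> ((1 - t) * \<bar>x\<bar> + t * \<bar>y\<bar>) powr p"
    using p by (intro powr_mono2) auto
  also have "\<dots> \<le> (1 - t) * \<bar>x\<bar> powr p + t * \<bar>y\<bar> powr p"
  \<comment> \<open>Points at 0 are treated apart from the convexity of \<open>powr\<close>: if one
    point is 0, only the scaling bound \<open>shrink\<close> for the other is left.\<close>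
  proof (cases "x = 0 \<or> y = 0")
    case True
    then show ?thesis using shrink[of t y] shrink[of "1 - t" x] t by auto
  next
    case False
    then show ?thesis using convex_onD[OF powr_convex[OF p], of t "\<bar>x\<bar>" "\<bar>y\<bar>"] t by simp
  qed
  finally show "\<bar>(1 - t) *\<^sub>R x + t *\<^sub>R y\<bar> powr p \<le> (1 - t) * \<bar>x\<bar> powr p + t * \<bar>y\<bar> powr p" .
qed simp

lemma integrable_lborel_affine:
  fixes f :: "'a::euclidean_space \<Rightarrow> real"
  assumes f: "integrable lborel f" and c: "c \<noteq> 0"
  shows "integrable lborel (\<lambda>x. f (b + c *\<^sub>R x))"
proof (rule integrableI_bounded)
  have [measurable]: "f \<in> borel_measurable borel" using f by auto
  show "(\<lambda>x. f (b + c *\<^sub>R x)) \<in> borel_measurable lborel" by measurable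
  show "(\<integral>\<^sup>+x. ennreal (norm (f (b + c *\<^sub>R x))) \<partial>lborel) < \<infinity>"
    using f nn_integral_lborel_affine[of "\<lambda>x. ennreal (norm (f x))" c b] c
    by (simp add: integrable_iff_bounded ennreal_mult_less_top)
qed

text \<open>Jensen's inequality for the probability measure with density \<open>\<eta>\<close>. With
  a nonnegative integral on the right the bound also covers the case where the p-th power is not
  integrable, the right side then being infinite. The free constant \<open>a\<close> will be the
  value of \<open>w\<close> at \<open>x\<close>.\<close>

lemma dil_avg_jensen:
  fixes w :: "real ^ 'n::finite \<Rightarrow> real"
  assumes \<eta>: "mollifier \<eta>" and w: "integrable lborel w" and p: "1 \<le> p" and t: "t \<noteq> 1"
  shows "ennreal (\<bar>dil_avg \<eta> w t x - a\<bar> powr p) \<le>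
    (\<integral>\<^sup>+z. ennreal (\<eta> z) * ennreal (\<bar>w (t *\<^sub>R x + (1 - t) *\<^sub>R z) - a\<bar> powr p) \<partial>lborel)"
proof -
  have \<eta>': "test_fun \<eta>" "\<And>z. 0 \<le> \<eta> z" "(LINT z|lborel. \<eta> z) = 1" using \<eta> by (auto simp: mollifier_def)
  have [measurable]: "w \<in> borel_measurable borel" "\<eta> \<in> borel_measurable borel"
    using w test_fun_measurable \<eta>' by auto
  let ?M = "density lborel (\<lambda>z. ennreal (\<eta> z))"
  let ?X = "\<lambda>z. w (t *\<^sub>R x + (1 - t) *\<^sub>R z) - a"
  let ?q = "\<lambda>r::real. \<bar>r\<bar> powr p"
  have "(\<integral>\<^sup>+z. ennreal (\<eta> z) \<partial>lborel) = 1"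
    using nn_integral_eq_integral[OF test_fun_integrable[OF \<eta>'(1)]] \<eta>' by simp
  then interpret prob_space ?M by (intro prob_spaceI) (simp add: emeasure_density)
  obtain M where M: "\<And>z. \<bar>\<eta> z\<bar> \<le> M" using test_fun_bounded[OF \<eta>'(1)] by metis
  have int: "integrable lborel (\<lambda>z. \<eta> z * w (t *\<^sub>R x + (1 - t) *\<^sub>R z))"
    by (rule integrable_bounded_mult[OF _ M]) (use integrable_lborel_affine[OF w] t in auto)
  have X: "integrable ?M ?X"
    using int test_fun_integrable[OF \<eta>'(1)] by (simp add: integrable_density \<eta>' right_diff_distrib)
  have EX: "expectation ?X = dil_avg \<eta> w t x - a"
    using int test_fun_integrable[OF \<eta>'(1)]
    by (simp add: integral_density \<eta>' right_diff_distrib dil_avg_def)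
  have "ennreal (?q (expectation ?X)) \<le> (\<integral>\<^sup>+z. ennreal (?q (?X z)) \<partial>?M)"
  proof (cases "integrable ?M (\<lambda>z. ?q (?X z))")
    case True
    have "?q (expectation ?X) \<le> expectation (\<lambda>z. ?q (?X z))"
      by (rule jensens_inequality[where I = UNIV]) (use X True convex_on_abs_powr[OF p] in auto)
    then show ?thesis using nn_integral_eq_integral[OF True] by (simp add: ennreal_leI)
  next
    case False
    moreover have "(\<lambda>z. ?q (?X z)) \<in> borel_measurable ?M" by simp
    ultimately have "(\<integral>\<^sup>+z. ennreal (?q (?X z)) \<partial>?M) = \<infinity>"
      by (simp add: integrable_iff_bounded less_top[symmetric])
    then show ?thesis by simp
  qed
  then show ?thesis by (simp add: EX nn_integral_density)
qed

text \<open>Two applications of dominated convergence: first \<open>w\<close> is clipped at a level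
  \<open>M\<close>, then the clipped function is approximated by clipped continuous functions.
  Clipping the approximants too provides a constant bound, which is integrable over the bounded set
  \<open>Q\<close>.\<close>

lemma Lp_approx_continuous:
  fixes w :: "real ^ 'n::finite \<Rightarrow> real"
  assumes w: "w \<in> borel_measurable borel" and p: "1 \<le> p"
    and int: "integrable lborel (\<lambda>x. indicator Q x * \<bar>w x\<bar> powr p)" and "0 < \<epsilon>"
  shows "\<exists>g. continuous_on UNIV g \<and>
    (\<integral>\<^sup>+x. ennreal (indicator Q x * \<bar>w x - g x\<bar> powr p) \<partial>lborel) \<le> ennreal \<epsilon>"
proof -
  note [measurable] = w
  define cl where "cl M r = max (- M) (min M r)" for M r :: real
  have cl_abs: "\<bar>r - cl M r\<bar> \<le> \<bar>r\<bar>" "\<bar>cl M r - cl M s\<bar> \<le> 2 * M" if "0 \<le> M" for M r s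
    using that by (auto simp: cl_def)
  have [measurable]: "cl M \<in> borel_measurable borel" for M unfolding cl_def[abs_def] by measurable
  have cont_cl: "continuous_on UNIV (cl M)" for M unfolding cl_def[abs_def] by (intro continuous_intros)
  \<comment> \<open>Half of \<open>\<epsilon>\<close> for each of the two errors, divided by the
    constant of \<open>abs_powr_sum3_le\<close>.\<close>
  define e where "e = \<epsilon> / (2 * 3 powr p)"
  have e: "0 < e" using \<open>0 < \<epsilon>\<close> by (simp add: e_def)
  let ?d = "\<lambda>a b x. indicator Q x * \<bar>a x - b x\<bar> powr p"
  have 1: "(\<lambda>M. LINT x|lborel. ?d w (\<lambda>x. cl (real M) (w x)) x) \<longlonglongrightarrow> (LINT x|(lborel :: (real ^ 'n) measure). 0)"
    "integrable lborel (?d w (\<lambda>x. cl (real M) (w x)))" for M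
  proof -
    have lim: "AE x in lborel. (\<lambda>M. ?d w (\<lambda>x. cl (real M) (w x)) x) \<longlonglongrightarrow> 0"
    proof (rule AE_I2)
      fix x
      obtain k :: nat where "\<bar>w x\<bar> \<le> real k" using real_arch_simple by blast
      then have "?d w (\<lambda>x. cl (real M) (w x)) x = 0" if "k \<le> M" for M
        using that by (auto simp: cl_def)
      then show "(\<lambda>M. ?d w (\<lambda>x. cl (real M) (w x)) x) \<longlonglongrightarrow> 0"
        by (intro tendsto_eventually eventually_sequentiallyI[of k])
    qed
    have bd: "AE x in lborel. norm (?d w (\<lambda>x. cl (real M) (w x)) x) \<le> indicator Q x * \<bar>w x\<bar> powr p" for M :: nat
      using p by (intro AE_I2) (auto simp: abs_mult intro!: mult_left_mono powr_mono2 cl_abs)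
    show "(\<lambda>M. LINT x|lborel. ?d w (\<lambda>x. cl (real M) (w x)) x) \<longlonglongrightarrow> (LINT x|(lborel :: (real ^ 'n) measure). 0)"
      by (rule integral_dominated_convergence[OF _ _ int lim bd]) measurable
    show "integrable lborel (?d w (\<lambda>x. cl (real M) (w x)))"
      by (rule integrable_dominated_convergence2[OF _ _ int lim bd]) measurable
  qed
  have "\<forall>\<^sub>F M in sequentially. (LINT x|lborel. ?d w (\<lambda>x. cl (real M) (w x)) x) < e"
    using order_tendstoD(2)[OF 1(1)] e by simp
  then obtain M :: nat where M: "(LINT x|lborel. ?d w (\<lambda>x. cl (real M) (w x)) x) < e"
    by (auto simp: eventually_sequentially)
  let ?c = "cl (real M)"
  \<comment> \<open>This notion of measurability supplies continuous functions converging to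
    \<open>w\<close> off a negligible set.\<close>
  have "w measurable_on UNIV"
    by (rule lebesgue_measurable_imp_measurable_on_real) (auto intro: measurable_completion)
  then obtain N G where N: "negligible N" and G: "\<And>n. continuous_on UNIV (G n)"
    and lim: "\<And>x. x \<notin> N \<Longrightarrow> (\<lambda>n. G n x) \<longlonglongrightarrow> w x"
    unfolding measurable_on_def by auto
  have [measurable]: "G n \<in> borel_measurable borel" for n using G borel_measurable_continuous_onI by blast
  have "AE x in lebesgue. x \<notin> N" using N negligible_iff_null_sets AE_not_in by blast
  then have aeN: "AE x in lborel. x \<notin> N" unfolding AE_completion_iff .
  have 2: "(\<lambda>n. LINT x|lborel. ?d (\<lambda>x. ?c (w x)) (\<lambda>x. ?c (G n x)) x) \<longlonglongrightarrow> (LINT x|(lborel :: (real ^ 'n) measure). 0)"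
    "integrable lborel (?d (\<lambda>x. ?c (w x)) (\<lambda>x. ?c (G n x)))" for n
  proof -
    have i: "integrable lborel (\<lambda>x::real^'n. indicator Q x * (2 * real M) powr p)"
      using emeasure_bounded_finite[OF bounded_Q] by (intro integrable_mult_left) auto
    have l: "AE x in lborel. (\<lambda>n. ?d (\<lambda>x. ?c (w x)) (\<lambda>x. ?c (G n x)) x) \<longlonglongrightarrow> 0"
      using aeN
    proof eventually_elim
      fix x assume "x \<notin> N"
      have "(\<lambda>n. ?c (G n x)) \<longlonglongrightarrow> ?c (w x)"
        using continuous_on_tendsto_compose[OF cont_cl lim[OF \<open>x \<notin> N\<close>]] by simp
      then have "(\<lambda>n. \<bar>?c (w x) - ?c (G n x)\<bar>) \<longlonglongrightarrow> \<bar>?c (w x) - ?c (w x)\<bar>"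
        by (intro tendsto_intros)
      then have "(\<lambda>n. \<bar>?c (w x) - ?c (G n x)\<bar> powr p) \<longlonglongrightarrow> 0"
        using p by (intro tendsto_zero_powrI[where b = p]) auto
      then show "(\<lambda>n. ?d (\<lambda>x. ?c (w x)) (\<lambda>x. ?c (G n x)) x) \<longlonglongrightarrow> 0"
        by (rule tendsto_mult_right_zero)
    qed
    have bd: "AE x in lborel. norm (?d (\<lambda>x. ?c (w x)) (\<lambda>x. ?c (G n x)) x) \<le> indicator Q x * (2 * real M) powr p" for n
      using p by (intro AE_I2) (auto simp: abs_mult intro!: mult_left_mono powr_mono2 cl_abs)
    show "(\<lambda>n. LINT x|lborel. ?d (\<lambda>x. ?c (w x)) (\<lambda>x. ?c (G n x)) x) \<longlonglongrightarrow> (LINT x|(lborel :: (real ^ 'n) measure). 0)"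
      by (rule integral_dominated_convergence[OF _ _ i l bd]) measurable
    show "integrable lborel (?d (\<lambda>x. ?c (w x)) (\<lambda>x. ?c (G n x)))"
      by (rule integrable_dominated_convergence2[OF _ _ i l bd]) measurable
  qed
  have "\<forall>\<^sub>F n in sequentially. (LINT x|lborel. ?d (\<lambda>x. ?c (w x)) (\<lambda>x. ?c (G n x)) x) < e"
    using order_tendstoD(2)[OF 2(1)] e by simp
  then obtain n where n: "(LINT x|lborel. ?d (\<lambda>x. ?c (w x)) (\<lambda>x. ?c (G n x)) x) < e"
    by (auto simp: eventually_sequentially)
  let ?g = "\<lambda>x. ?c (G n x)"
  let ?b = "\<lambda>x. 3 powr p * (?d w (\<lambda>x. ?c (w x)) x + ?d (\<lambda>x. ?c (w x)) ?g x)"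
  have ib: "integrable lborel ?b" by (intro integrable_mult_right Bochner_Integration.integrable_add 1(2) 2(2))
  have "(\<integral>\<^sup>+x. ennreal (?d w ?g x) \<partial>lborel) \<le> (\<integral>\<^sup>+x. ennreal (?b x) \<partial>lborel)"
  proof (intro nn_integral_mono ennreal_leI)
    fix x
    have "\<bar>w x - ?g x\<bar> powr p \<le> 3 powr p * (\<bar>w x - ?c (w x)\<bar> powr p + \<bar>?c (w x) - ?g x\<bar> powr p)"
      using abs_powr_sum3_le[of p "w x - ?c (w x)" "?c (w x) - ?g x" 0] p by simp
    then show "?d w ?g x \<le> ?b x" by (auto simp: indicator_def)
  qed
  also have "\<dots> = ennreal (LINT x|lborel. ?b x)"
    using ib by (intro nn_integral_eq_integral) auto
  also have "(LINT x|lborel. ?b x) \<le> 3 powr p * (e + e)"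
    using M n 1(2)[of M] 2(2)[of n] by simp
  also have "3 powr p * (e + e) = \<epsilon>" by (simp add: e_def)
  finally have "(\<integral>\<^sup>+x. ennreal (?d w ?g x) \<partial>lborel) \<le> ennreal \<epsilon>" using ennreal_leI by simp
  moreover have "continuous_on UNIV ?g"
    using continuous_on_compose2[OF cont_cl G] by simp
  ultimately show ?thesis by blast
qed

lemma emeasure_Q: "emeasure lborel (Q :: (real ^ 'n::finite) set) = 1"
  unfolding Q_eq_box by (subst emeasure_lborel_box) (auto simp: Basis_vec_def inner_axis intro!: prod.neutral)

text \<open>Compare \<open>w\<close> at the dilated point and at \<open>x\<close> through
  \<open>g\<close> at both points. The error at the dilated point costs the Jacobian, at most 2^N
  because \<open>t\<close> is at least 1/2; the oscillation of \<open>g\<close> contributes \<delta>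
  times the measure 1 of \<open>Q\<close>; the error at \<open>x\<close> contributes
  \<open>E\<close>.\<close>

lemma dil_avg_Lp_bound:
  fixes w g :: "real ^ 'n::finite \<Rightarrow> real"
  assumes \<eta>: "mollifier \<eta>" and w: "integrable lborel w" and p: "1 \<le> p" and t: "1/2 \<le> t" "t < 1"
    and g: "continuous_on UNIV g"
    and E: "(\<integral>\<^sup>+x. ennreal (indicator Q x * \<bar>w x - g x\<bar> powr p) \<partial>lborel) \<le> ennreal E" "0 \<le> E"
    and \<delta>: "\<And>x z. x \<in> Q \<Longrightarrow> z \<in> Q \<Longrightarrow> \<bar>g (t *\<^sub>R x + (1 - t) *\<^sub>R z) - g x\<bar> powr p \<le> \<delta>" "0 \<le> \<delta>"
  shows "(\<integral>\<^sup>+x. ennreal (indicator Q x * \<bar>dil_avg \<eta> w t x - w x\<bar> powr p) \<partial>lborel)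
    \<le> ennreal (3 powr p * (2 ^ CARD('n) * E + \<delta> + E))"
proof -
  have \<eta>': "test_fun \<eta>" "\<And>z. 0 \<le> \<eta> z" "(LINT z|lborel. \<eta> z) = 1" using \<eta> by (auto simp: mollifier_def)
  have [measurable]: "w \<in> borel_measurable borel" "\<eta> \<in> borel_measurable borel" "g \<in> borel_measurable borel"
    using w test_fun_measurable \<eta>' g borel_measurable_continuous_onI by auto
  have \<eta>1: "(\<integral>\<^sup>+z. ennreal (\<eta> z) \<partial>lborel) = 1"
    using nn_integral_eq_integral[OF test_fun_integrable[OF \<eta>'(1)]] \<eta>' by simp
  \<comment> \<open>The indicator lets \<open>H\<close> be integrated over the whole space after the
    substitution, while its integral is still the error on \<open>Q\<close>.\<close>
  define H where "H y = ennreal (indicator Q y * \<bar>w y - g y\<bar> powr p)" for y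
  have [measurable]: "H \<in> borel_measurable borel" unfolding H_def[abs_def] by measurable
  define C where "C = ennreal (3 powr p)"
  let ?y = "\<lambda>x z. t *\<^sub>R x + (1 - t) *\<^sub>R z"
  have pt: "ennreal (\<eta> z) * ennreal (\<bar>w (?y x z) - w x\<bar> powr p) \<le>
      ennreal (\<eta> z) * (C * (H (?y x z) + (ennreal \<delta> + H x)))" if x: "x \<in> Q" for x z
  proof (cases "z \<in> Q")
    case False
    then show ?thesis using test_fun_outside[OF \<eta>'(1)] by simp
  next
    case True
    then have y: "?y x z \<in> Q" using x t by (intro mem_Q_dilation) auto
    have "\<bar>w (?y x z) - w x\<bar> powr p \<le> 3 powr p *
        (\<bar>w (?y x z) - g (?y x z)\<bar> powr p + \<bar>g (?y x z) - g x\<bar> powr p + \<bar>g x - w x\<bar> powr p)"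
      using abs_powr_sum3_le[of p "w (?y x z) - g (?y x z)" "g (?y x z) - g x" "g x - w x"] p by simp
    also have "\<dots> \<le> 3 powr p * (\<bar>w (?y x z) - g (?y x z)\<bar> powr p + (\<delta> + \<bar>w x - g x\<bar> powr p))"
      using \<delta>(1)[OF x True] by (intro mult_left_mono) (auto simp: abs_minus_commute)
    finally have "ennreal (\<bar>w (?y x z) - w x\<bar> powr p) \<le> ennreal \<dots>" by (rule ennreal_leI)
    also have "\<dots> = C * (H (?y x z) + (ennreal \<delta> + H x))"
      using x y \<delta>(2) by (simp add: C_def H_def ennreal_mult ennreal_plus)
    finally show ?thesis by (rule mult_left_mono) simp
  qed
  let ?A = "\<lambda>x. \<integral>\<^sup>+z. ennreal (\<eta> z) * H (?y x z) \<partial>lborel"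
  have "ennreal (indicator Q x * \<bar>dil_avg \<eta> w t x - w x\<bar> powr p) \<le> C * (?A x + (ennreal \<delta> * indicator Q x + H x))" for x
  proof (cases "x \<in> Q")
    case True
    have "ennreal (\<bar>dil_avg \<eta> w t x - w x\<bar> powr p) \<le>
        (\<integral>\<^sup>+z. ennreal (\<eta> z) * ennreal (\<bar>w (?y x z) - w x\<bar> powr p) \<partial>lborel)"
      using t by (intro dil_avg_jensen \<eta> w p) simp
    also have "\<dots> \<le> (\<integral>\<^sup>+z. ennreal (\<eta> z) * (C * (H (?y x z) + (ennreal \<delta> + H x))) \<partial>lborel)"
      by (intro nn_integral_mono pt True)
    also have "\<dots> = (\<integral>\<^sup>+z. C * (ennreal (\<eta> z) * H (?y x z)) + ennreal (\<eta> z) * (C * (ennreal \<delta> + H x)) \<partial>lborel)"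
      by (simp add: distrib_left mult_ac)
    also have "\<dots> = C * ?A x + C * (ennreal \<delta> + H x)"
      by (simp add: nn_integral_add nn_integral_cmult nn_integral_multc \<eta>1)
    finally show ?thesis using True by (simp add: distrib_left add_ac)
  qed simp
  then have "(\<integral>\<^sup>+x. ennreal (indicator Q x * \<bar>dil_avg \<eta> w t x - w x\<bar> powr p) \<partial>lborel) \<le>
      (\<integral>\<^sup>+x. C * (?A x + (ennreal \<delta> * indicator Q x + H x)) \<partial>lborel)" by (intro nn_integral_mono)
  also have "\<dots> = C * ((\<integral>\<^sup>+x. ?A x \<partial>lborel) + (ennreal \<delta> + (\<integral>\<^sup>+x. H x \<partial>lborel)))"
    by (simp add: nn_integral_cmult nn_integral_add emeasure_Q)
  also have "(\<integral>\<^sup>+x. ?A x \<partial>lborel) = (\<integral>\<^sup>+z. \<integral>\<^sup>+x. ennreal (\<eta> z) * H (?y x z) \<partial>lborel \<partial>lborel)"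
    by (rule lborel_pair.Fubini') measurable
  also have "\<dots> = (\<integral>\<^sup>+z. ennreal (\<eta> z) * (\<integral>\<^sup>+x. H ((1 - t) *\<^sub>R z + t *\<^sub>R x) \<partial>lborel) \<partial>lborel)"
    by (simp add: nn_integral_cmult add.commute)
  also have "\<dots> = (\<integral>\<^sup>+z. ennreal (\<eta> z) * (ennreal (1 / \<bar>t\<bar> ^ CARD('n)) * (\<integral>\<^sup>+x. H x \<partial>lborel)) \<partial>lborel)"
    using t by (subst nn_integral_lborel_affine) auto
  also have "\<dots> = ennreal (1 / \<bar>t\<bar> ^ CARD('n)) * (\<integral>\<^sup>+x. H x \<partial>lborel)"
    by (simp add: nn_integral_multc \<eta>1)
  also have "C * (ennreal (1 / \<bar>t\<bar> ^ CARD('n)) * (\<integral>\<^sup>+x. H x \<partial>lborel) + (ennreal \<delta> + (\<integral>\<^sup>+x. H x \<partial>lborel)))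
      \<le> C * (ennreal (2 ^ CARD('n)) * ennreal E + (ennreal \<delta> + ennreal E))"
  proof (intro mult_left_mono add_mono mult_mono ennreal_leI)
    have "(1 / \<bar>t\<bar>) ^ CARD('n) \<le> 2 ^ CARD('n)"
      using t by (intro power_mono) (auto simp: divide_le_eq)
    then show "1 / \<bar>t\<bar> ^ CARD('n) \<le> 2 ^ CARD('n)" by (simp add: power_divide)
  qed (use E in \<open>auto simp: H_def\<close>)
  also have "\<dots> = ennreal (3 powr p * (2 ^ CARD('n) * E + \<delta> + E))"
    using E(2) \<delta>(2) by (simp add: C_def ennreal_mult ennreal_plus add.assoc)
  finally show ?thesis .
qed

lemma dil_avg_Lp_tendsto:
  fixes w :: "real ^ 'n::finite \<Rightarrow> real"
  assumes \<eta>: "mollifier \<eta>" and w: "integrable lborel w" and p: "1 \<le> p"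
    and wp: "integrable lborel (\<lambda>x. indicator Q x * \<bar>w x\<bar> powr p)"
    and t: "\<And>n::nat. 1/2 \<le> t n" "\<And>n. t n < 1" "t \<longlonglongrightarrow> 1"
  shows "(\<lambda>n. LINT x|lborel. indicator Q x * \<bar>dil_avg \<eta> w (t n) x - w x\<bar> powr p) \<longlonglongrightarrow> 0"
proof (rule order_tendstoI)
  fix a :: real assume "a < 0"
  moreover have "0 \<le> (LINT x|lborel. indicator Q x * \<bar>dil_avg \<eta> w (t n) x - w x\<bar> powr p)" for n
    by (intro Bochner_Integration.integral_nonneg) simp
  ultimately show "\<forall>\<^sub>F n in sequentially. a < (LINT x|lborel. indicator Q x * \<bar>dil_avg \<eta> w (t n) x - w x\<bar> powr p)"
    using less_le_trans by (intro always_eventually) blast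
next
  fix \<epsilon> :: real assume \<epsilon>: "0 < \<epsilon>"
  \<comment> \<open>The coefficient of \<delta> in \<open>dil_avg_Lp_bound\<close> when the
    approximation error and the oscillation are both \<delta>; the target is then half of
    \<epsilon>.\<close>
  define K where "K = 3 powr p * (2 ^ CARD('n) + 2)"
  define \<delta> where "\<delta> = \<epsilon> / (2 * K)"
  have K: "0 < K" by (simp add: K_def add_pos_pos)
  then have \<delta>: "0 < \<delta>" using \<epsilon> by (simp add: \<delta>_def)
  have "3 powr p * (2 ^ CARD('n) * \<delta> + \<delta> + \<delta>) = K * \<delta>" by (simp add: K_def algebra_simps)
  also have "\<dots> = \<epsilon> / 2" using K by (simp add: \<delta>_def)
  finally have K\<delta>: "3 powr p * (2 ^ CARD('n) * \<delta> + \<delta> + \<delta>) = \<epsilon> / 2" .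
  have "w \<in> borel_measurable borel" using w by auto
  then obtain g where g: "continuous_on UNIV g"
    and gE: "(\<integral>\<^sup>+x. ennreal (indicator Q x * \<bar>w x - g x\<bar> powr p) \<partial>lborel) \<le> ennreal \<delta>"
    using Lp_approx_continuous[OF _ p wp \<delta>] by blast
  have "uniformly_continuous_on (closure Q) g"
    using bounded_Q g by (intro compact_uniformly_continuous continuous_on_subset[OF g]) auto
  \<comment> \<open>Uniform continuity is used at this threshold because its p-th power is
    \<delta>.\<close>
  moreover have "0 < \<delta> powr (1 / p)" using \<delta> by simp
  ultimately obtain \<rho> where \<rho>: "0 < \<rho>"
    "\<And>x y. x \<in> closure Q \<Longrightarrow> y \<in> closure Q \<Longrightarrow> dist y x < \<rho> \<Longrightarrow> dist (g y) (g x) < \<delta> powr (1 / p)"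
    unfolding uniformly_continuous_on_def by metis
  obtain D where D: "\<And>x. x \<in> (Q :: (real^'n) set) \<Longrightarrow> norm x \<le> D"
    using bounded_Q unfolding bounded_iff by metis
  \<comment> \<open>A dilation with center z moves x by (1 - t)(z - x), whose norm is at most (1 -
    t) 2D on \<open>Q\<close>, uniformly in both points.\<close>
  have "(\<lambda>n. (1 - t n) * (2 * D)) \<longlonglongrightarrow> (1 - 1) * (2 * D)" by (intro tendsto_intros t)
  then have "\<forall>\<^sub>F n in sequentially. (1 - t n) * (2 * D) < \<rho>"
    using \<rho>(1) order_tendstoD(2) by fastforce
  then show "\<forall>\<^sub>F n in sequentially. (LINT x|lborel. indicator Q x * \<bar>dil_avg \<eta> w (t n) x - w x\<bar> powr p) < \<epsilon>"
  proof eventually_elim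
    fix n assume n: "(1 - t n) * (2 * D) < \<rho>"
    have "\<bar>g (t n *\<^sub>R x + (1 - t n) *\<^sub>R z) - g x\<bar> powr p \<le> \<delta>" if xz: "x \<in> Q" "z \<in> Q" for x z
    proof -
      let ?y = "t n *\<^sub>R x + (1 - t n) *\<^sub>R z"
      have t01: "0 \<le> t n" "t n \<le> 1" using t(1,2)[of n] by auto
      have "?y - x = (1 - t n) *\<^sub>R (z - x)" by (simp add: algebra_simps)
      then have "dist ?y x = (1 - t n) * norm (z - x)" using t01 by (simp add: dist_norm)
      also have "\<dots> \<le> (1 - t n) * (2 * D)"
        using D[OF xz(1)] D[OF xz(2)] norm_triangle_ineq4[of z x] t01 by (intro mult_left_mono) auto
      finally have "dist ?y x < \<rho>" using n by simp
      moreover have "?y \<in> Q" using xz t01 by (intro mem_Q_dilation)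
      ultimately have "dist (g ?y) (g x) < \<delta> powr (1 / p)"
        using \<rho>(2) xz closure_subset by blast
      then have "\<bar>g ?y - g x\<bar> powr p \<le> (\<delta> powr (1 / p)) powr p"
        using p by (intro powr_mono2) (auto simp: dist_real_def)
      also have "\<dots> = \<delta>" using \<delta> p by (simp add: powr_powr)
      finally show ?thesis .
    qed
    then have "(\<integral>\<^sup>+x. ennreal (indicator Q x * \<bar>dil_avg \<eta> w (t n) x - w x\<bar> powr p) \<partial>lborel)
        \<le> ennreal (3 powr p * (2 ^ CARD('n) * \<delta> + \<delta> + \<delta>))"
      using \<delta> by (intro dil_avg_Lp_bound[OF \<eta> w p t(1,2) g gE]) auto
    then have "(LINT x|lborel. indicator Q x * \<bar>dil_avg \<eta> w (t n) x - w x\<bar> powr p) \<le> \<epsilon> / 2"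
      unfolding K\<delta> using \<epsilon> by (intro integral_real_bounded) auto
    then show "(LINT x|lborel. indicator Q x * \<bar>dil_avg \<eta> w (t n) x - w x\<bar> powr p) < \<epsilon>" using \<epsilon> by simp
  qed
qed

subsection \<open>Approximation\<close>

lemma integrable_on_Q_continuous:
  fixes f :: "real ^ 'n::finite \<Rightarrow> real"
  assumes f: "continuous_on UNIV f"
  shows "integrable (lebesgue_on Q) f"
proof -
  have m: "f \<in> borel_measurable borel" using f by (rule borel_measurable_continuous_onI)
  have c: "compact (closure Q :: (real ^ 'n) set)" using bounded_Q by simp
  have i: "integrable lborel (\<lambda>x. indicator (closure Q) x *\<^sub>R f x)"
    by (rule borel_integrable_compact[OF c continuous_on_subset[OF f subset_UNIV]])
  have "integrable lborel (\<lambda>x. indicator Q x * f x)"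
  proof (rule Bochner_Integration.integrable_bound[OF i])
    show "(\<lambda>x. indicator Q x * f x) \<in> borel_measurable lborel" using m by measurable
    show "AE x in lborel. norm (indicator Q x * f x) \<le> norm (indicator (closure Q) x *\<^sub>R f x)"
      using closure_subset[of Q] by (intro AE_I2) (auto simp: indicator_def)
  qed
  then show ?thesis using integral_on_Q(2)[OF m] by simp
qed

lemma borel_measurable_lebesgue_on: "f \<in> borel_measurable borel \<Longrightarrow> f \<in> borel_measurable (lebesgue_on Q)"
  by (intro measurable_restrict_space1 measurable_completion) simp

text \<open>\<open>u\<close> is measurable only for the completed measure, while Fubini and the
  substitutions run over \<open>lborel\<close>. Vanishing off \<open>Q\<close> identifies integrals
  over the cube with integrals over the space.\<close>

lemma borel_representative_on_Q:
  fixes u :: "real ^ 'n::finite \<Rightarrow> real"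
  assumes u: "u \<in> borel_measurable (lebesgue_on Q)"
  obtains w where "w \<in> borel_measurable borel" "\<And>x. x \<notin> Q \<Longrightarrow> w x = 0" "AE x in lebesgue_on Q. u x = w x"
proof -
  have Q: "Q \<inter> space lebesgue \<in> sets (lebesgue :: (real ^ 'n) measure)" by simp
  have "(\<lambda>x. indicator Q x *\<^sub>R u x) \<in> borel_measurable lebesgue"
    using u borel_measurable_restrict_space_iff[OF Q] by blast
  then obtain g where g: "g \<in> borel_measurable lborel" "AE x in lborel. indicator Q x *\<^sub>R u x = g x"
    using completion_ex_borel_measurable_real by blast
  have [measurable]: "g \<in> borel_measurable borel" using g by simp
  show thesis
  proof
    show "(\<lambda>x. indicator Q x * g x) \<in> borel_measurable borel" by measurable
    have "AE x in lebesgue. indicator Q x *\<^sub>R u x = g x" using g(2) by (rule AE_completion)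
    then have "AE x in lebesgue. x \<in> Q \<longrightarrow> u x = indicator Q x * g x"
      by eventually_elim (auto simp: indicator_def)
    then show "AE x in lebesgue_on Q. u x = indicator Q x * g x"
      using AE_restrict_space_iff[OF Q] by blast
  qed simp
qed

lemma PV_cong_AE:
  fixes u w :: "real ^ 'n::finite \<Rightarrow> real"
  assumes "u \<in> borel_measurable (lebesgue_on Q)" "w \<in> borel_measurable (lebesgue_on Q)"
    "AE x in lebesgue_on Q. u x = w x"
  shows "PV d B u = PV d B w"
  unfolding PV_alt
proof (intro SUP_cong refl arg_cong[where f = ereal] integral_cong_AE)
  fix \<phi> assume "\<phi> \<in> {\<phi>. admissible d (\<phi> :: 'n list \<Rightarrow> real ^ 'n \<Rightarrow> real)}"
  then have [measurable]: "adjoint_formula d B \<phi> \<in> borel_measurable (lebesgue_on Q)"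
    by (intro borel_measurable_lebesgue_on test_fun_measurable test_fun_adjoint_formula) (simp add: admissible_def)
  show "(\<lambda>x. u x * adjoint_formula d B \<phi> x) \<in> borel_measurable (lebesgue_on Q)"
    "(\<lambda>x. w x * adjoint_formula d B \<phi> x) \<in> borel_measurable (lebesgue_on Q)"
    using assms by (auto intro!: borel_measurable_times)
  show "AE x in lebesgue_on Q. u x * adjoint_formula d B \<phi> x = w x * adjoint_formula d B \<phi> x"
    using assms(3) by eventually_elim simp
qed

text \<open>The zero field is admissible. Together with finiteness this makes \<open>PV\<close> a
  real number, as the division by a power of \<open>t\<close> requires.\<close>

lemma PV_nonneg:
  fixes B :: "'n::finite diff_op"
  shows "0 \<le> PV d B u"
proof -
  have "iter_deriv J (\<lambda>x. 0) = (\<lambda>x. 0)" for J :: "'n list"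
    by (induction J) (auto simp: partial_deriv_const)
  then have "adjoint_formula d B (\<lambda>I x. 0) = (\<lambda>x. 0)" by (intro ext) (simp add: adjoint_formula_def)
  moreover have "admissible d (\<lambda>I x. 0)" by (simp add: admissible_def test_field_def test_fun_zero)
  ultimately show ?thesis unfolding PV_alt
    by (intro SUP_upper2[of "\<lambda>I x. 0"]) auto
qed

text \<open>Since \<psi> is bounded, pairing with it is continuous in \<open>L\<^sup>1\<close>.
  \<open>PV\<close> is a supremum of such pairings, hence lower semicontinuous.\<close>

lemma integral_mult_test_fun_tendsto:
  fixes w \<psi> :: "real ^ 'n::finite \<Rightarrow> real"
  assumes \<psi>: "test_fun \<psi>"
    and v: "\<And>n::nat. integrable (lebesgue_on Q) (v n)" and w: "integrable (lebesgue_on Q) w"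
    and lim: "(\<lambda>n. LINT x|lebesgue_on Q. \<bar>v n x - w x\<bar>) \<longlonglongrightarrow> 0"
  shows "(\<lambda>n. LINT x|lebesgue_on Q. v n x * \<psi> x) \<longlonglongrightarrow> (LINT x|lebesgue_on Q. w x * \<psi> x)"
proof -
  obtain M where M: "\<And>x. \<bar>\<psi> x\<bar> \<le> M" using test_fun_bounded[OF \<psi>] by metis
  have [measurable]: "\<psi> \<in> borel_measurable (lebesgue_on Q)"
    by (intro borel_measurable_lebesgue_on test_fun_measurable \<psi>)
  have int: "integrable (lebesgue_on Q) (\<lambda>x. f x * \<psi> x)" if f: "integrable (lebesgue_on Q) f" for f
  proof (rule Bochner_Integration.integrable_bound)
    show "integrable (lebesgue_on Q) (\<lambda>x. f x * M)" using f by simp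
    show "(\<lambda>x. f x * \<psi> x) \<in> borel_measurable (lebesgue_on Q)"
      using f by (intro borel_measurable_times) auto
    have "\<bar>\<psi> x\<bar> \<le> \<bar>M\<bar>" for x using M[of x] by linarith
    then show "AE x in lebesgue_on Q. norm (f x * \<psi> x) \<le> norm (f x * M)"
      by (intro AE_I2) (simp add: abs_mult mult_left_mono)
  qed
  have est: "norm ((LINT x|lebesgue_on Q. v n x * \<psi> x) - (LINT x|lebesgue_on Q. w x * \<psi> x)) \<le>
      M * (LINT x|lebesgue_on Q. \<bar>v n x - w x\<bar>)" for n
  proof -
    have "(LINT x|lebesgue_on Q. v n x * \<psi> x) - (LINT x|lebesgue_on Q. w x * \<psi> x) =
        (LINT x|lebesgue_on Q. (v n x - w x) * \<psi> x)"
      unfolding left_diff_distrib by (rule Bochner_Integration.integral_diff[symmetric]) (intro int v w)+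
    also have "norm \<dots> \<le> (LINT x|lebesgue_on Q. M * \<bar>v n x - w x\<bar>)"
    proof (rule order_trans[OF integral_norm_bound integral_mono])
      have i: "integrable (lebesgue_on Q) (\<lambda>x. v n x - w x)"
        by (intro Bochner_Integration.integrable_diff v w)
      show "integrable (lebesgue_on Q) (\<lambda>x. norm ((v n x - w x) * \<psi> x))"
        by (intro integrable_norm int i)
      show "integrable (lebesgue_on Q) (\<lambda>x. M * \<bar>v n x - w x\<bar>)"
        by (intro integrable_mult_right integrable_abs i)
      show "norm ((v n x - w x) * \<psi> x) \<le> M * \<bar>v n x - w x\<bar>" for x
        using mult_right_mono[OF M, of "\<bar>v n x - w x\<bar>" x] by (simp add: abs_mult mult.commute)
    qed
    finally show ?thesis by simp
  qed
  have "(\<lambda>n. M * (LINT x|lebesgue_on Q. \<bar>v n x - w x\<bar>)) \<longlonglongrightarrow> 0"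
    using tendsto_mult_right_zero[OF lim] .
  then show ?thesis
    by (rule LIM_zero_cancel[OF Lim_null_comparison[OF always_eventually[OF allI[OF est]]]])
qed

theorem theorem2p6:
  fixes B :: "'n::finite diff_op"
    and d :: nat
    and p :: real
    and u :: "real ^ 'n \<Rightarrow> real"
  assumes "1 \<le> d"
    and "1 \<le> p"
    and "u \<in> BV d B \<inter> Lp p"
  shows "\<exists>v :: nat \<Rightarrow> real ^ 'n \<Rightarrow> real.
    (\<forall>n. smooth_on Q (v n) \<and> v n \<in> BV d B) \<and>
    (\<forall>n. v n \<in> Lp p) \<and> (\<lambda>n. Lp_norm p (\<lambda>x. v n x - u x)) \<longlonglongrightarrow> 0 \<and>
    (\<lambda>n. PV d B (v n)) \<longlonglongrightarrow> PV d B u \<and>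
    (\<forall>n. smooth_closure (v n))"
proof -
  have p: "1 \<le> p" by fact
  have u: "integrable (lebesgue_on Q) u" "PV d B u < \<infinity>"
    "integrable (lebesgue_on Q) (\<lambda>x. \<bar>u x\<bar> powr p)"
    using assms(3) by (auto simp: BV_def Lp_def)
  have um: "u \<in> borel_measurable (lebesgue_on Q)" using u(1) by simp
  obtain w where w: "w \<in> borel_measurable borel" "\<And>x. x \<notin> Q \<Longrightarrow> w x = 0"
    and ae: "AE x in lebesgue_on Q. u x = w x"
    using borel_representative_on_Q[OF um] by metis
  have wm: "w \<in> borel_measurable (lebesgue_on Q)" by (rule borel_measurable_lebesgue_on[OF w(1)])
  note [measurable] = um wm w(1)
  have wQ: "integrable (lebesgue_on Q) w" using integrable_cong_AE_imp[OF u(1) wm] ae by auto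
  have ind: "(\<lambda>x. indicator Q x * w x) = w" by (intro ext) (auto simp: indicator_def w(2))
  have wi: "integrable lborel w" using wQ integral_on_Q(2)[OF w(1)] by (simp only: ind)
  have "AE x in lebesgue_on Q. \<bar>w x\<bar> powr p = \<bar>u x\<bar> powr p" using ae by eventually_elim simp
  then have "integrable (lebesgue_on Q) (\<lambda>x. \<bar>w x\<bar> powr p)"
    using integrable_cong_AE[of "\<lambda>x. \<bar>w x\<bar> powr p" "lebesgue_on Q" "\<lambda>x. \<bar>u x\<bar> powr p"] u(3) by simp
  then have wp: "integrable lborel (\<lambda>x. indicator Q x * \<bar>w x\<bar> powr p)"
    by (subst integral_on_Q(2)[symmetric]) auto
  \<comment> \<open>The exponent 1 instance: whatever \<open>p\<close> is, convergence in
    \<open>L\<^sup>1\<close> is what lower semicontinuity of \<open>PV\<close> will use.\<close>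
  have w1: "integrable lborel (\<lambda>x. indicator Q x * \<bar>w x\<bar> powr 1)"
  proof -
    have "(\<lambda>x. indicator Q x * \<bar>w x\<bar> powr 1) = (\<lambda>x. \<bar>w x\<bar>)"
      by (intro ext) (auto simp: indicator_def w(2))
    then show ?thesis using integrable_abs[OF wi] by (simp only:)
  qed
  have PV: "PV d B u = PV d B w" by (rule PV_cong_AE[OF um wm ae])
  obtain P where P: "PV d B w = ereal P"
    using u(2) PV_nonneg[of d B w] unfolding PV by (cases "PV d B w") auto
  obtain \<eta> :: "real ^ 'n \<Rightarrow> real" where \<eta>: "mollifier \<eta>" using mollifier_exists by blast
  \<comment> \<open>The shift by 2 makes the sequence start at 1/2, the lower limit in
    \<open>dil_avg_Lp_bound\<close>.\<close>
  define t where "t n = 1 - 1 / (real n + 2)" for n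
  have t: "1/2 \<le> t n" "t n < 1" "0 < t n" for n by (auto simp: t_def field_simps)
  have t_lim: "t \<longlonglongrightarrow> 1" unfolding t_def[abs_def]
    using tendsto_diff[OF tendsto_const LIMSEQ_ignore_initial_segment[OF lim_inverse_n', of 2], of "1::real"]
    by (simp add: add.commute)
  define v where "v n = dil_avg \<eta> w (t n)" for n
  have smooth: "smooth_on UNIV (v n)" for n
    unfolding v_def using smooth_on_dil_avg[OF _ wi] \<eta> t(2)[of n] by (simp add: mollifier_def)
  have cont: "continuous_on UNIV (v n)" for n by (rule smooth_on_continuous[OF smooth])
  have [measurable]: "v n \<in> borel_measurable borel" for n
    by (rule borel_measurable_continuous_onI[OF cont])
  have vm [measurable]: "v n \<in> borel_measurable (lebesgue_on Q)" for n by (rule borel_measurable_lebesgue_on) simp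
  have vQ: "integrable (lebesgue_on Q) (v n)" for n by (rule integrable_on_Q_continuous[OF cont])
  have PV_le: "PV d B (v n) \<le> ereal (P / t n ^ CARD('n))" for n
    unfolding v_def by (rule PV_dil_avg_le[OF \<eta> wi t(3,2)]) (simp add: P)
  have conv: "(\<lambda>n. LINT x|lebesgue_on Q. \<bar>v n x - w x\<bar> powr q) \<longlonglongrightarrow> 0"
    if "1 \<le> q" "integrable lborel (\<lambda>x. indicator Q x * \<bar>w x\<bar> powr q)" for q
  proof -
    have "(LINT x|lebesgue_on Q. \<bar>v n x - w x\<bar> powr q) =
        (LINT x|lborel. indicator Q x * \<bar>v n x - w x\<bar> powr q)" for n
      by (rule integral_on_Q(1)) measurable
    then show ?thesis unfolding v_def using dil_avg_Lp_tendsto[OF \<eta> wi that t(1,2) t_lim] by simp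
  qed
  show ?thesis
  proof (intro exI[of _ v] conjI allI)
    show "smooth_on Q (v n)" for n using smooth_on_subset[OF smooth] by blast
    show "smooth_closure (v n)" for n unfolding smooth_closure_def using smooth by blast
    show "v n \<in> BV d B" for n
      using vQ PV_le[of n] by (auto simp: BV_def intro: le_less_trans)
    show "v n \<in> Lp p" for n
    proof -
      have "continuous_on UNIV (\<lambda>x. \<bar>v n x\<bar> powr p)"
        by (rule continuous_on_powr'[OF continuous_on_rabs[OF cont] continuous_on_const]) (use p in auto)
      then show ?thesis unfolding Lp_def using vm integrable_on_Q_continuous by blast
    qed
    have "(\<lambda>n. Lp_norm p (\<lambda>x. v n x - u x)) =
        (\<lambda>n. (LINT x|lebesgue_on Q. \<bar>v n x - w x\<bar> powr p) powr (1 / p))"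
    proof
      fix n
      have "AE x in lebesgue_on Q. \<bar>v n x - u x\<bar> powr p = \<bar>v n x - w x\<bar> powr p"
        using ae by eventually_elim simp
      then have "(LINT x|lebesgue_on Q. \<bar>v n x - u x\<bar> powr p) = (LINT x|lebesgue_on Q. \<bar>v n x - w x\<bar> powr p)"
        by (intro integral_cong_AE) auto
      then show "Lp_norm p (\<lambda>x. v n x - u x) = (LINT x|lebesgue_on Q. \<bar>v n x - w x\<bar> powr p) powr (1 / p)"
        by (simp add: Lp_norm_def)
    qed
    then show "(\<lambda>n. Lp_norm p (\<lambda>x. v n x - u x)) \<longlonglongrightarrow> 0"
      using p by (simp only:) (intro tendsto_zero_powrI[OF conv[OF p wp] tendsto_const] always_eventually allI
          Bochner_Integration.integral_nonneg; simp)
    show "(\<lambda>n. PV d B (v n)) \<longlonglongrightarrow> PV d B u" unfolding PV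
    proof (rule order_tendstoI)
      \<comment> \<open>Lower semicontinuity: a field whose pairing with \<open>w\<close> exceeds
        \<open>a\<close> does so with \<open>v n\<close> for large \<open>n\<close>.\<close>
      fix a assume "a < PV d B w"
      then obtain \<phi> where \<phi>: "admissible d \<phi>" "a < ereal (LINT x|lebesgue_on Q. w x * adjoint_formula d B \<phi> x)"
        unfolding PV_alt less_SUP_iff by blast
      have "(\<lambda>n. LINT x|lebesgue_on Q. v n x * adjoint_formula d B \<phi> x) \<longlonglongrightarrow>
          (LINT x|lebesgue_on Q. w x * adjoint_formula d B \<phi> x)"
      proof (rule integral_mult_test_fun_tendsto[OF _ vQ wQ])
        show "test_fun (adjoint_formula d B \<phi>)"
          using \<phi>(1) by (intro test_fun_adjoint_formula) (simp add: admissible_def)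
        show "(\<lambda>n. LINT x|lebesgue_on Q. \<bar>v n x - w x\<bar>) \<longlonglongrightarrow> 0"
          using conv[OF order_refl w1] by simp
      qed
      then have "(\<lambda>n. ereal (LINT x|lebesgue_on Q. v n x * adjoint_formula d B \<phi> x)) \<longlonglongrightarrow>
          ereal (LINT x|lebesgue_on Q. w x * adjoint_formula d B \<phi> x)" by (rule tendsto_ereal)
      from order_tendstoD(1)[OF this \<phi>(2)]
      show "\<forall>\<^sub>F n in sequentially. a < PV d B (v n)"
      proof eventually_elim
        fix n assume "a < ereal (LINT x|lebesgue_on Q. v n x * adjoint_formula d B \<phi> x)"
        also have "\<dots> \<le> PV d B (v n)" unfolding PV_alt using \<phi>(1) by (intro SUP_upper) simp
        finally show "a < PV d B (v n)" .
      qed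
    next
      \<comment> \<open>Upper half: the bound \<open>PV_le\<close> tends to the variation of
        \<open>w\<close>, as \<open>t n\<close> tends to 1.\<close>
      fix a assume a: "PV d B w < a"
      have "(\<lambda>n. P / t n ^ CARD('n)) \<longlonglongrightarrow> P / 1 ^ CARD('n)"
        by (intro tendsto_intros t_lim) simp
      then have "(\<lambda>n. ereal (P / t n ^ CARD('n))) \<longlonglongrightarrow> PV d B w" unfolding P by simp
      from order_tendstoD(2)[OF this a]
      show "\<forall>\<^sub>F n in sequentially. PV d B (v n) < a"
        by eventually_elim (rule le_less_trans[OF PV_le])
    qed
  qed
qed

end
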